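(* Let $N\ge2$ be an integer and $m>-1$. For $\epsilon\in(0,\frac12)$ set $$C_{1,\epsilon}:=\{(x',\lambda)\in\mathbb R^{N-1}\times\mathbb R:|x'|<1,\ |\lambda|<1-\epsilon^{1+m}\}.$$ Let $\alpha>-1$ and $\beta>0$ satisfy $$-2\alpha(1+m)<\beta m<2(1+m),$$ and let $$2\le P\le P_{cr}(N,m,\alpha,\beta):=\frac{2\left(N+\frac{2\alpha(1+m)+\beta m}{2(1+m)-\beta m}\right)}{N+\frac{2\alpha(1+m)+\beta m}{2(1+m)-\beta m}-2}.$$ Then there exists a positive constant $C=C(N,P,m,\alpha,\beta)$, independent of $\epsilon$, such that for every $\epsilon\in(0,\frac12)$ and every $f\in C_0^\infty(C_{1,\epsilon})$ $$\left(\int_{C_{1,\epsilon}}(1-|\lambda|)^\alpha|f(x',\lambda)|^P\,dx'\,d\lambda\right)^{\frac2P}\le C\int_{C_{1,\epsilon}}(1-|\lambda|)^\alpha\left(|\nabla_{x'}f|^2+\frac{(1-|\lambda|)^\beta}{\epsilon^\beta}|\partial_\lambda f|^2\right)dx'\,d\lambda.$$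
   Context: $C_0^\infty(U)$ denotes the smooth real-valued functions with compact support in the open set $U$. $\nabla_{x'}$ is the gradient in the variables $x'\in\mathbb R^{N-1}$. *)

theory Defs
  imports "HOL-Analysis.Analysis"
begin

definition cylinder :: "real \<Rightarrow> real \<Rightarrow> ((real ^ 'n) \<times> real) set" where
  "cylinder m \<epsilon> = {(x, l). norm x < 1 \<and> \<bar>l\<bar> < 1 - \<epsilon> powr (1 + m)}"

definition P_cr :: "nat \<Rightarrow> real \<Rightarrow> real \<Rightarrow> real \<Rightarrow> real" where
  "P_cr N m \<alpha> \<beta> =
     2 * (real N + (2 * \<alpha> * (1 + m) + \<beta> * m) / (2 * (1 + m) - \<beta> * m)) /
     (real N + (2 * \<alpha> * (1 + m) + \<beta> * m) / (2 * (1 + m) - \<beta> * m) - 2)"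

text \<open>Class \<open>C\<^sup>k\<close> on an open set, by recursion on the directional derivatives;
  \<open>S\<close> should be open, since derivatives are taken at \<open>x\<close> without restriction to \<open>S\<close>.\<close>

primrec Ck_on :: "nat \<Rightarrow> 'a::real_normed_vector set \<Rightarrow> ('a \<Rightarrow> real) \<Rightarrow> bool" where
  "Ck_on 0 S f \<longleftrightarrow> continuous_on S f"
| "Ck_on (Suc k) S f \<longleftrightarrow>
     (\<forall>x\<in>S. f differentiable (at x)) \<and>
     (\<forall>v. Ck_on k S (\<lambda>x. frechet_derivative f (at x) v))"

text \<open>Elements of \<open>C\<^sub>0\<^sup>\<infinity>(U)\<close> are represented by their extension by zero to the whole space.\<close>

definition test_functions :: "'a::real_normed_vector set \<Rightarrow> ('a \<Rightarrow> real) set" where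
  "test_functions U = {f. (\<forall>k. Ck_on k U f) \<and>
     compact (closure {x. f x \<noteq> 0}) \<and> closure {x. f x \<noteq> 0} \<subseteq> U}"

definition gradient :: "('a::real_inner \<Rightarrow> real) \<Rightarrow> 'a \<Rightarrow> 'a" where
  "gradient g x = (THE D. GDERIV g x :> D)"

end

theory Submission
  imports Defs
begin

text \<open>
  Put \<open>\<gamma> = \<beta> m / (1 + m)\<close>. On the cylinder the distance \<open>t = 1 - \<bar>\<lambda>\<bar>\<close> exceeds \<open>\<epsilon>\<^sup>1\<^sup>+\<^sup>m\<close>,
  hence \<open>t\<^sup>\<beta> / \<epsilon>\<^sup>\<beta> \<ge> t\<^sup>\<gamma>\<close>, and \<open>\<epsilon>\<close> disappears from the estimate: it suffices to bound the
  weighted \<open>L\<^sup>P\<close> norm by the energy with weights \<open>t\<^sup>\<alpha>\<close> and \<open>t\<^sup>\<alpha>\<^sup>+\<^sup>\<gamma>\<close>. The substitution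
  \<open>1 - \<bar>\<lambda>\<bar> = (1 - \<bar>p\<bar>)\<^sup>q\<close> with \<open>q = 2 / (2 - \<gamma>)\<close> makes this energy isotropic and turns the
  measure into \<open>(1 - \<bar>p\<bar>)\<^sup>k dx dp\<close>, both up to constants, with \<open>k = (2 \<alpha> + \<gamma>) / (2 - \<gamma>) > 0\<close>. The number \<open>P_cr\<close> is the
  Sobolev exponent \<open>2 Q / (Q - 2)\<close> of the homogeneous dimension \<open>Q = N + k\<close>, and what remains is a
  Sobolev inequality for a weight \<open>d\<^sup>k\<close> with \<open>d\<close> positive and concave on a convex set.

  That inequality is proved by moving points towards a fixed set \<open>B\<close> in the interior. For
  \<open>z\<^sub>\<theta>(y) = (1 - \<theta>) z + \<theta> y\<close> with \<open>y \<in> B\<close>, concavity of \<open>d\<close> has two effects.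
  First, as long as \<open>\<theta> \<le> 1/2\<close>, the image of the weighted measure \<open>\<mu>\<close> under \<open>z \<mapsto> z\<^sub>\<theta>(y)\<close> is bounded
  by a constant multiple of \<open>\<mu>\<close> (\<open>nn_integral_contraction_le\<close>). Second, the points \<open>y \<in> B\<close> that send \<open>z\<close> into a given set
  \<open>A\<close> have Lebesgue measure at most a constant times \<open>\<theta>\<^sup>-\<^sup>Q \<mu>(A)\<close>
  (\<open>emeasure_contraction_preimage_le\<close>). Take \<open>A = {\<bar>u\<bar> \<ge> c}\<close> and \<open>\<theta>\<^sup>Q\<close> proportional to
  \<open>\<mu>(A)\<close>: then every \<open>z\<close> with \<open>\<bar>u z\<bar> \<ge> 2 c\<close> is carried by at least half of \<open>B\<close> to a point where
  \<open>\<bar>u\<bar> \<le> c\<close>. Along each such segment \<open>u\<close> crosses the band \<open>c < \<bar>u\<bar> < 2 c\<close>, which costs Dirichlet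
  energy inside that band only. Averaging over \<open>y\<close> and integrating over \<open>z\<close> gives
  \<open>c\<^sup>2 \<mu>{\<bar>u\<bar> \<ge> 2 c} \<le> K \<mu>{\<bar>u\<bar> \<ge> c}\<^sup>\<delta> \<integral>\<^bsub>c < \<bar>u\<bar> < 2 c\<^esub> \<bar>\<nabla>u\<bar>\<^sup>2 d\<mu>\<close> for
  \<open>0 \<le> \<delta> \<le> 2 / Q\<close> (\<open>superlevel_decay\<close>).

  With \<open>\<delta> = 1 - 2 / P\<close>, the condition \<open>\<delta> \<le> 2 / Q\<close> is exactly \<open>P \<le> P_cr\<close>. Summing over dyadic
  levels, whose bands are disjoint, and using Markov's inequality for the factor
  \<open>\<mu>{\<bar>u\<bar> \<ge> c}\<^sup>\<delta>\<close> yields \<open>I \<le> C I\<^sup>\<delta> \<integral>\<bar>\<nabla>u\<bar>\<^sup>2 d\<mu>\<close> for \<open>I = \<integral>\<bar>u\<bar>\<^sup>P d\<mu>\<close>, that is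
  \<open>I\<^bsup>2 / P\<^esup> \<le> C \<integral>\<bar>\<nabla>u\<bar>\<^sup>2 d\<mu>\<close>. The lateral boundary condition enters only for large level sets, where
  \<open>\<theta> = 1/2\<close>: \<open>B\<close> is placed so far to the side that the midpoint of a point of the support and a point of \<open>B\<close> is
  never in the support.
\<close>

section \<open>Levels of functions of one variable\<close>

text \<open>The Cauchy-Schwarz inequality on an interval of length at most one, obtained by integrating
  \<open>0 \<le> (h' - M)\<^sup>2\<close> for the increment \<open>M\<close>.\<close>

lemma increment_sq_le_energy:
  fixes h h' :: "real \<Rightarrow> real"
  assumes ab: "a \<le> b" "b - a \<le> 1"
    and deriv: "\<And>t. t \<in> {a..b} \<Longrightarrow> (h has_real_derivative h' t) (at t within {a..b})"
    and cont: "continuous_on {a..b} h'"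
  shows "ennreal ((h b - h a)\<^sup>2) \<le> (\<integral>\<^sup>+ t. ennreal ((h' t)\<^sup>2) * indicator {a..b} t \<partial>lborel)"
proof -
  define M where "M = h b - h a"
  have i2: "integrable lborel (\<lambda>t. indicator {a..b} t *\<^sub>R (h' t)\<^sup>2)"
    using borel_integrable_atLeastAtMost'[of a b "\<lambda>t. (h' t)\<^sup>2"] cont
    unfolding set_integrable_def by (auto intro!: continuous_intros)
  have i1: "((\<lambda>t. h' t) has_integral M) {a..b}"
    unfolding M_def using ab deriv
    by (intro fundamental_theorem_of_calculus) (auto simp: has_real_derivative_iff_has_vector_derivative)
  have "((\<lambda>t. 2 * M * h' t - M\<^sup>2) has_integral (2 * M * M - (b - a) *\<^sub>R M\<^sup>2)) {a..b}"
    using ab by (intro has_integral_diff has_integral_mult_right i1)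
      (use has_integral_const_real[of "M\<^sup>2" a b] in auto)
  moreover have "((\<lambda>t. (h' t)\<^sup>2) has_integral integral {a..b} (\<lambda>t. (h' t)\<^sup>2)) {a..b}"
    using cont by (intro integrable_integral integrable_continuous_real continuous_intros)
  ultimately have "2 * M * M - (b - a) *\<^sub>R M\<^sup>2 \<le> integral {a..b} (\<lambda>t. (h' t)\<^sup>2)"
  proof (rule has_integral_le)
    fix t
    have "0 \<le> (h' t - M)\<^sup>2" by simp
    then show "2 * M * h' t - M\<^sup>2 \<le> (h' t)\<^sup>2" by (simp add: power2_diff mult_ac)
  qed
  moreover have "(b - a) * M\<^sup>2 \<le> 1 * M\<^sup>2" using ab by (intro mult_right_mono) auto
  ultimately have "M\<^sup>2 \<le> integral {a..b} (\<lambda>t. (h' t)\<^sup>2)"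
    by (simp add: power2_eq_square)
  also have "\<dots> = (LBINT t. indicator {a..b} t *\<^sub>R (h' t)\<^sup>2)"
    using set_borel_integral_eq_integral(2)[of "{a..b}" "\<lambda>t. (h' t)\<^sup>2"] i2
    by (simp add: set_integrable_def set_lebesgue_integral_def)
  finally have "ennreal (M\<^sup>2) \<le> ennreal (LBINT t. indicator {a..b} t *\<^sub>R (h' t)\<^sup>2)"
    by (rule ennreal_leI)
  also have "\<dots> = (\<integral>\<^sup>+ t. ennreal (indicator {a..b} t *\<^sub>R (h' t)\<^sup>2) \<partial>lborel)"
    using i2 by (intro nn_integral_eq_integral[symmetric]) auto
  also have "\<dots> = (\<integral>\<^sup>+ t. ennreal ((h' t)\<^sup>2) * indicator {a..b} t \<partial>lborel)"
    by (intro nn_integral_cong) (auto split: split_indicator)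
  finally show ?thesis unfolding M_def .
qed

text \<open>Between the last time at which \<open>\<bar>h\<bar> \<ge> 2 c\<close> and the first later time at which \<open>\<bar>h\<bar> \<le> c\<close> the values
  stay strictly inside the band, and \<open>h\<close> changes by at least \<open>c\<close>. Charging only the energy spent inside
  the band is what later allows the contributions of different levels to be added without
  overlap.\<close>

lemma level_crossing_energy:
  fixes h h' :: "real \<Rightarrow> real"
  assumes deriv: "\<And>t. t \<in> {0..1} \<Longrightarrow> (h has_real_derivative h' t) (at t within {0..1})"
    and cont: "continuous_on {0..1} h'"
    and c: "2 * c \<le> \<bar>h 0\<bar>" "\<bar>h 1\<bar> \<le> c" "0 < c"
  shows "ennreal (c\<^sup>2) \<le>
    (\<integral>\<^sup>+ t. ennreal ((h' t)\<^sup>2) * indicator {0..1} t * indicator {t. c < \<bar>h t\<bar> \<and> \<bar>h t\<bar> < 2 * c} t \<partial>lborel)"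
proof -
  have ch: "continuous_on {0..1} h"
    using deriv by (rule DERIV_continuous_on)
  have "compact {t\<in>{0..1}. 2 * c \<le> \<bar>h t\<bar>}"
    using ch unfolding compact_eq_bounded_closed
    by (intro conjI continuous_on_closed_Collect_le continuous_intros)
       (auto intro: bounded_subset[OF bounded_closed_interval[of 0 1]])
  moreover have "0 \<in> {t\<in>{0..1}. 2 * c \<le> \<bar>h t\<bar>}" using c by auto
  ultimately obtain t0 where t0: "t0 \<in> {0..1}" "2 * c \<le> \<bar>h t0\<bar>"
    and t0_max: "\<And>t. t \<in> {0..1} \<Longrightarrow> 2 * c \<le> \<bar>h t\<bar> \<Longrightarrow> t \<le> t0"
    using compact_attains_sup[of "{t\<in>{0..1}. 2 * c \<le> \<bar>h t\<bar>}"] by blast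
  have "compact {t\<in>{t0..1}. \<bar>h t\<bar> \<le> c}"
    using continuous_on_subset[OF ch, of "{t0..1}"] t0 unfolding compact_eq_bounded_closed
    by (intro conjI continuous_on_closed_Collect_le continuous_intros)
       (auto intro: bounded_subset[OF bounded_closed_interval[of t0 1]])
  moreover have "1 \<in> {t\<in>{t0..1}. \<bar>h t\<bar> \<le> c}" using c t0 by auto
  ultimately obtain t1 where t1: "t1 \<in> {t0..1}" "\<bar>h t1\<bar> \<le> c"
    and t1_min: "\<And>t. t \<in> {t0..1} \<Longrightarrow> \<bar>h t\<bar> \<le> c \<Longrightarrow> t1 \<le> t"
    using compact_attains_inf[of "{t\<in>{t0..1}. \<bar>h t\<bar> \<le> c}"] by blast
  have sub: "{t0..t1} \<subseteq> {0..1}" using t0 t1 by auto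
  have "c \<le> \<bar>h t1 - h t0\<bar>" using t0 t1 by linarith
  then have "c\<^sup>2 \<le> (h t1 - h t0)\<^sup>2"
    using \<open>0 < c\<close> by (metis abs_le_square_iff abs_of_pos)
  then have "ennreal (c\<^sup>2) \<le> ennreal ((h t1 - h t0)\<^sup>2)" by (rule ennreal_leI)
  also have "\<dots> \<le> (\<integral>\<^sup>+ t. ennreal ((h' t)\<^sup>2) * indicator {t0..t1} t \<partial>lborel)"
    using t0 t1 sub
    by (intro increment_sq_le_energy DERIV_subset[OF deriv] continuous_on_subset[OF cont]) auto
  also have "\<dots> \<le> (\<integral>\<^sup>+ t. ennreal ((h' t)\<^sup>2) * indicator {0..1} t
      * indicator {t. c < \<bar>h t\<bar> \<and> \<bar>h t\<bar> < 2 * c} t \<partial>lborel)"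
  proof (rule nn_integral_mono_AE)
    have "AE t in lborel. t \<noteq> t0" "AE t in lborel. t \<noteq> t1"
      by (rule AE_lborel_singleton)+
    then show "AE t in lborel. ennreal ((h' t)\<^sup>2) * indicator {t0..t1} t
      \<le> ennreal ((h' t)\<^sup>2) * indicator {0..1} t * indicator {t. c < \<bar>h t\<bar> \<and> \<bar>h t\<bar> < 2 * c} t"
    proof eventually_elim
      case (elim t)
      show ?case
      proof (cases "t \<in> {t0..t1}")
        case True
        then have "\<not> 2 * c \<le> \<bar>h t\<bar>" "\<not> \<bar>h t\<bar> \<le> c"
          using t0_max[of t] t1_min[of t] sub t1 elim by force+
        then show ?thesis using True sub by (auto split: split_indicator)
      qed auto
    qed
  qed
  finally show ?thesis .
qed

lemma dyadic_level:
  fixes c x :: real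
  assumes "0 < c" "c \<le> x"
  obtains i :: nat where "c * 2 ^ i \<le> x" "x < 2 * (c * 2 ^ i)"
proof -
  define i where "i = (LEAST i. x < c * 2 ^ Suc i)"
  obtain n where "x / c < 2 ^ n" using real_arch_pow[of 2 "x / c"] by auto
  then have "x < c * 2 ^ Suc n" using assms by (simp add: field_simps)
  then have i: "x < c * 2 ^ Suc i" unfolding i_def by (rule LeastI)
  have "c * 2 ^ i \<le> x"
  proof (cases i)
    case (Suc j)
    then have "\<not> x < c * 2 ^ Suc j" unfolding i_def by (intro not_less_Least) auto
    then show ?thesis using Suc by simp
  qed (use assms in auto)
  with i show ?thesis by (intro that[of i]) auto
qed

section \<open>Contractions and concave power weights\<close>

lemma nn_integral_lborel_affine:
  fixes g :: "'a::euclidean_space \<Rightarrow> ennreal"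
  assumes [measurable]: "g \<in> borel_measurable borel" and c: "c > 0"
  shows "(\<integral>\<^sup>+ z. g (t + c *\<^sub>R z) \<partial>lborel) = ennreal (c powr (- real DIM('a))) * (\<integral>\<^sup>+ z. g z \<partial>lborel)"
proof -
  have "(\<integral>\<^sup>+ z. g z \<partial>lborel) = (\<integral>\<^sup>+ z. g z \<partial>density (distr lborel borel (\<lambda>x::'a. t + c *\<^sub>R x)) (\<lambda>_. ennreal (\<bar>c\<bar> ^ DIM('a))))"
    using c by (subst lborel_affine[of c t]) auto
  also have "\<dots> = ennreal (c ^ DIM('a)) * (\<integral>\<^sup>+ z. g (t + c *\<^sub>R z) \<partial>lborel)"
    using c by (simp add: nn_integral_density nn_integral_distr nn_integral_cmult)
  finally have "ennreal (c powr (- real DIM('a))) * (\<integral>\<^sup>+ z. g z \<partial>lborel) =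
    ennreal (c powr (- real DIM('a)) * c ^ DIM('a)) * (\<integral>\<^sup>+ z. g (t + c *\<^sub>R z) \<partial>lborel)"
    using c by (simp add: ennreal_mult mult.assoc)
  also have "c powr (- real DIM('a)) * c ^ DIM('a) = 1"
    using c by (simp add: powr_minus powr_realpow)
  finally show ?thesis by simp
qed

text \<open>The weight is \<open>d\<^sup>k\<close>; the set \<open>B\<close>, on which \<open>d\<close> is bounded below, is the target of the contractions
  \<open>z \<mapsto> (1 - \<theta>) z + \<theta> y\<close>, \<open>y \<in> B\<close>.\<close>

locale concave_power_weight =
  fixes \<Omega> B :: "'a::euclidean_space set" and d :: "'a \<Rightarrow> real" and k R :: real
  assumes open_dom: "open \<Omega>" and convex_dom: "convex \<Omega>"
    and diam: "\<And>y z. y \<in> \<Omega> \<Longrightarrow> z \<in> \<Omega> \<Longrightarrow> norm (y - z) \<le> R"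
    and B_dom: "B \<subseteq> \<Omega>" and B_sets [measurable]: "B \<in> sets borel"
    and B_pos: "0 < measure lborel B" 
    and d_meas [measurable]: "d \<in> borel_measurable borel"
    and d_pos: "\<And>z. z \<in> \<Omega> \<Longrightarrow> 0 < d z" and d_le: "\<And>z. z \<in> \<Omega> \<Longrightarrow> d z \<le> 1"
    and d_concave: "\<And>y z s. y \<in> \<Omega> \<Longrightarrow> z \<in> \<Omega> \<Longrightarrow> 0 \<le> s \<Longrightarrow> s \<le> 1 \<Longrightarrow>
      (1 - s) * d z + s * d y \<le> d ((1 - s) *\<^sub>R z + s *\<^sub>R y)"
    and d_B: "\<And>y. y \<in> B \<Longrightarrow> 1 / 2 \<le> d y"
    and k_nonneg: "0 \<le> k"
begin

definition weight :: "'a \<Rightarrow> ennreal" where "weight z = ennreal (d z powr k) * indicator \<Omega> z"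

definition \<mu> :: "'a measure" where "\<mu> = density lborel weight"

text \<open>The homogeneous dimension: near a point where \<open>d\<close> vanishes linearly, \<open>\<mu>\<close>-balls of radius \<open>r\<close> have
  measure comparable to \<open>r\<close> to this power.\<close>

definition hdim :: real where "hdim = real DIM('a) + k"

lemma dom_sets [measurable]: "\<Omega> \<in> sets borel"
  using open_dom by auto

lemma weight_meas [measurable]: "weight \<in> borel_measurable borel"
  unfolding weight_def by measurable

lemma sets_\<mu> [simp, measurable_cong]: "sets \<mu> = sets borel"
  unfolding \<mu>_def by simp

lemma space_\<mu> [simp]: "space \<mu> = UNIV"
  unfolding \<mu>_def by simp

lemma nn_integral_\<mu>: "g \<in> borel_measurable borel \<Longrightarrow> (\<integral>\<^sup>+ z. g z \<partial>\<mu>) = (\<integral>\<^sup>+ z. weight z * g z \<partial>lborel)"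
  unfolding \<mu>_def by (rule nn_integral_density) auto

lemma emeasure_dom_finite: "emeasure lborel \<Omega> < \<infinity>"
proof -
  have "bounded \<Omega>"
  proof (cases "\<Omega> = {}")
    case False
    then obtain y where "y \<in> \<Omega>" by blast
    then show ?thesis using diam unfolding bounded_def dist_norm by blast
  qed auto
  then show ?thesis by (rule emeasure_bounded_finite)
qed

lemma weight_le: "weight z \<le> indicator \<Omega> z"
proof (cases "z \<in> \<Omega>")
  case True
  then have "d z powr k \<le> 1 powr k"
    using d_pos d_le k_nonneg by (intro powr_mono2) (auto intro: less_imp_le)
  then show ?thesis using True by (simp add: weight_def)
qed (simp add: weight_def)

lemma finite_measure_\<mu>: "finite_measure \<mu>"
proof (rule finite_measureI)
  have "emeasure \<mu> UNIV = (\<integral>\<^sup>+ z. weight z \<partial>lborel)"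
    unfolding \<mu>_def by (simp add: emeasure_density)
  also have "\<dots> \<le> (\<integral>\<^sup>+ z. indicator \<Omega> z \<partial>lborel)" by (intro nn_integral_mono weight_le)
  also have "\<dots> < \<infinity>" using emeasure_dom_finite by simp
  finally show "emeasure \<mu> (space \<mu>) \<noteq> \<infinity>" by simp
qed

text \<open>Concavity and positivity of \<open>d\<close> give \<open>d z \<le> 2 d ((1 - s) z + s y)\<close>, so the weight grows by at most
  \<open>2\<^sup>k\<close>, while the Jacobian of the contraction contributes \<open>(1 - s)\<close> to the power minus the dimension.\<close>

lemma nn_integral_contraction_le:
  assumes [measurable]: "g \<in> borel_measurable borel" and s: "0 \<le> s" "s \<le> 1 / 2" and y: "y \<in> \<Omega>"
  shows "(\<integral>\<^sup>+ z. weight z * g ((1 - s) *\<^sub>R z + s *\<^sub>R y) \<partial>lborel) \<le> ennreal (2 powr hdim) * (\<integral>\<^sup>+ z. g z \<partial>\<mu>)"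
proof -
  have weight: "weight z \<le> ennreal (2 powr k) * weight ((1 - s) *\<^sub>R z + s *\<^sub>R y)" for z
  proof (cases "z \<in> \<Omega>")
    case True
    let ?z = "(1 - s) *\<^sub>R z + s *\<^sub>R y"
    have in_dom: "?z \<in> \<Omega>" using convexD[OF convex_dom True y, of "1 - s" s] s by auto
    have "1 / 2 * d z \<le> (1 - s) * d z + s * d y"
      using s d_pos[OF True] d_pos[OF y] by (intro add_increasing2 mult_right_mono) auto
    also have "\<dots> \<le> d ?z" using d_concave[OF y True] s by auto
    finally have "d z \<le> 2 * d ?z" by simp
    then have "d z powr k \<le> (2 * d ?z) powr k"
      using d_pos[OF True] k_nonneg by (intro powr_mono2) auto
    also have "\<dots> = 2 powr k * d ?z powr k" using d_pos[OF in_dom] by (simp add: powr_mult)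
    finally show ?thesis using True in_dom
      by (simp add: weight_def ennreal_mult[symmetric])
  qed (simp add: weight_def)
  have "(\<integral>\<^sup>+ z. weight z * g ((1 - s) *\<^sub>R z + s *\<^sub>R y) \<partial>lborel) \<le>
     (\<integral>\<^sup>+ z. ennreal (2 powr k) * (weight (s *\<^sub>R y + (1 - s) *\<^sub>R z) * g (s *\<^sub>R y + (1 - s) *\<^sub>R z)) \<partial>lborel)"
    by (intro nn_integral_mono) (use weight in \<open>auto simp: add.commute mult.assoc[symmetric] intro!: mult_right_mono\<close>)
  also have "\<dots> = ennreal (2 powr k) * (ennreal ((1 - s) powr (- real DIM('a))) * (\<integral>\<^sup>+ z. weight z * g z \<partial>lborel))"
    using s by (simp add: nn_integral_cmult nn_integral_lborel_affine[of "\<lambda>z. weight z * g z" "1 - s" "s *\<^sub>R y"])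
  also have "\<dots> \<le> ennreal (2 powr k) * (ennreal (2 powr (real DIM('a))) * (\<integral>\<^sup>+ z. weight z * g z \<partial>lborel))"
  proof (intro mult_left_mono mult_right_mono ennreal_leI)
    have "(1 - s) powr (- real DIM('a)) \<le> (1 / 2) powr (- real DIM('a))"
      using s by (intro powr_mono2') auto
    then show "(1 - s) powr (- real DIM('a)) \<le> 2 powr (real DIM('a))"
      by (simp add: powr_minus powr_divide)
  qed auto
  also have "\<dots> = ennreal (2 powr hdim) * (\<integral>\<^sup>+ z. g z \<partial>\<mu>)"
    by (simp add: nn_integral_\<mu> hdim_def powr_add ennreal_mult mult_ac)
  finally show ?thesis .
qed

text \<open>The image of \<open>B\<close> is a copy of \<open>B\<close> scaled by \<open>\<theta>\<close>, and there \<open>d \<ge> \<theta> / 2\<close> by concavity. Hence the density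
  of \<open>\<mu>\<close> on it is at least \<open>(\<theta> / 2)\<^sup>k\<close>, wherever \<open>z\<close> lies; this uniformity up to the boundary, where
  the weight degenerates, is the source of the exponent \<open>k\<close> in the homogeneous dimension.\<close>

lemma emeasure_contraction_preimage_le:
  assumes [measurable]: "A \<in> sets borel" and \<theta>: "0 < \<theta>" "\<theta> \<le> 1" and z: "z \<in> \<Omega>"
  shows "emeasure lborel {y \<in> B. (1 - \<theta>) *\<^sub>R z + \<theta> *\<^sub>R y \<in> A} \<le>
    ennreal (2 powr k * \<theta> powr (- hdim)) * emeasure \<mu> A"
proof -
  have "emeasure lborel {y \<in> B. (1 - \<theta>) *\<^sub>R z + \<theta> *\<^sub>R y \<in> A} =
     (\<integral>\<^sup>+ y. indicator {y \<in> B. (1 - \<theta>) *\<^sub>R z + \<theta> *\<^sub>R y \<in> A} y \<partial>lborel)"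
    by (subst nn_integral_indicator) auto
  also have "\<dots> \<le> (\<integral>\<^sup>+ y. ennreal (2 powr k * \<theta> powr (- k)) *
      (weight ((1 - \<theta>) *\<^sub>R z + \<theta> *\<^sub>R y) * indicator A ((1 - \<theta>) *\<^sub>R z + \<theta> *\<^sub>R y)) \<partial>lborel)"
  proof (intro nn_integral_mono)
    fix y
    let ?z = "(1 - \<theta>) *\<^sub>R z + \<theta> *\<^sub>R y"
    show "indicator {y \<in> B. (1 - \<theta>) *\<^sub>R z + \<theta> *\<^sub>R y \<in> A} y \<le>
       ennreal (2 powr k * \<theta> powr (- k)) * (weight ?z * indicator A ?z)"
    proof (cases "y \<in> B \<and> ?z \<in> A")
      case True
      then have y: "y \<in> \<Omega>" using B_dom by auto
      have in_dom: "?z \<in> \<Omega>" using convexD[OF convex_dom z y, of "1 - \<theta>" \<theta>] \<theta> by auto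
      have "\<theta> / 2 \<le> \<theta> * d y" using True d_B[of y] \<theta> by auto
      also have "\<dots> \<le> (1 - \<theta>) * d z + \<theta> * d y" using d_pos[OF z] \<theta> by auto
      also have "\<dots> \<le> d ?z" using d_concave[OF y z] \<theta> by auto
      finally have "1 \<le> 2 / \<theta> * d ?z" using \<theta> by (simp add: field_simps)
      then have "1 powr k \<le> (2 / \<theta> * d ?z) powr k" using k_nonneg by (intro powr_mono2) auto
      also have "\<dots> = 2 powr k * \<theta> powr (- k) * d ?z powr k"
        using \<theta> d_pos[OF in_dom] by (simp add: powr_mult powr_divide powr_minus field_simps)
      finally have "1 \<le> ennreal (2 powr k * \<theta> powr (- k) * d ?z powr k)" by simp
      also have "\<dots> = ennreal (2 powr k * \<theta> powr (- k)) * ennreal (d ?z powr k)"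
        by (rule ennreal_mult) auto
      finally show ?thesis using True in_dom by (simp add: weight_def)
    qed auto
  qed
  also have "\<dots> = ennreal (2 powr k * \<theta> powr (- k)) *
      (ennreal (\<theta> powr (- real DIM('a))) * (\<integral>\<^sup>+ y. weight y * indicator A y \<partial>lborel))"
    using \<theta> by (simp add: nn_integral_cmult nn_integral_lborel_affine[of "\<lambda>z. weight z * indicator A z" \<theta>])
  also have "\<dots> = ennreal (2 powr k * \<theta> powr (- hdim)) * emeasure \<mu> A"
  proof -
    have "- hdim = - k + - real DIM('a)" by (simp add: hdim_def)
    then have "\<theta> powr (- hdim) = \<theta> powr (- k) * \<theta> powr (- real DIM('a))"
      by (simp only: powr_add)
    then show ?thesis
      by (simp add: \<mu>_def emeasure_density ennreal_mult mult.assoc)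
  qed
  finally show ?thesis .
qed

text \<open>The constant of the level set inequality \<open>superlevel_decay\<close>; it depends on the geometry and on \<open>\<delta>\<close>,
  but on no function.\<close>

definition decay_const :: "real \<Rightarrow> real" where
  "decay_const \<delta> = 2 * R\<^sup>2 * 2 powr hdim * (2 * 2 powr k / measure lborel B) powr \<delta>"

end

section \<open>Decay of superlevel sets\<close>

text \<open>The hypothesis \<open>midpoint_zero\<close> is a Dirichlet condition in disguise: the half-way contraction
  moves the set \<open>{u \<noteq> 0}\<close> off itself. It excludes nonzero constants and so replaces a Poincare inequality.\<close>

locale C1_dirichlet_function = concave_power_weight \<Omega> B d k R
  for \<Omega> B :: "'a::euclidean_space set" and d :: "'a \<Rightarrow> real" and k R :: real +
  fixes u :: "'a \<Rightarrow> real" and G :: "'a \<Rightarrow> 'a"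
  assumes u_meas [measurable]: "u \<in> borel_measurable borel"
    and G_meas [measurable]: "G \<in> borel_measurable borel"
    and gderiv: "\<And>z. z \<in> \<Omega> \<Longrightarrow> (u has_derivative (\<lambda>v. v \<bullet> G z)) (at z)"
    and G_cont: "continuous_on \<Omega> G"
    and midpoint_zero: "\<And>y z. z \<in> \<Omega> \<Longrightarrow> y \<in> B \<Longrightarrow> u z \<noteq> 0 \<Longrightarrow> u ((1 / 2) *\<^sub>R z + (1 / 2) *\<^sub>R y) = 0"
begin

definition band :: "real \<Rightarrow> 'a set" where
  "band c = {z. c < \<bar>u z\<bar> \<and> \<bar>u z\<bar> < 2 * c}"

lemma band_sets [measurable]: "band c \<in> sets borel"
  unfolding band_def by measurable

lemma level_crossing_on_segment:
  assumes z: "z \<in> \<Omega>" and y: "y \<in> \<Omega>" and \<theta>: "0 \<le> \<theta>" "\<theta> \<le> 1" and c: "0 < c"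
    and top: "2 * c \<le> \<bar>u z\<bar>" and bot: "\<bar>u ((1 - \<theta>) *\<^sub>R z + \<theta> *\<^sub>R y)\<bar> \<le> c"
  shows "ennreal (c\<^sup>2) \<le> ennreal ((\<theta> * R)\<^sup>2) *
    (\<integral>\<^sup>+ t. ennreal ((norm (G ((1 - \<theta> * t) *\<^sub>R z + (\<theta> * t) *\<^sub>R y)))\<^sup>2)
       * indicator (band c) ((1 - \<theta> * t) *\<^sub>R z + (\<theta> * t) *\<^sub>R y) * indicator {0..1} t \<partial>lborel)"
proof -
  define p where "p t = (1 - \<theta> * t) *\<^sub>R z + (\<theta> * t) *\<^sub>R y" for t
  define h' where "h' t = (\<theta> *\<^sub>R (y - z)) \<bullet> G (p t)" for t
  have p_dom: "p t \<in> \<Omega>" if "t \<in> {0..1}" for t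
    using convexD[OF convex_dom z y, of "1 - \<theta> * t" "\<theta> * t"] \<theta> that mult_le_one[of \<theta> t]
    by (auto simp: p_def)
  have p_deriv: "(p has_derivative (\<lambda>x. x *\<^sub>R (\<theta> *\<^sub>R (y - z)))) (at t within {0..1})" for t
    unfolding p_def by (auto intro!: derivative_eq_intros simp: algebra_simps)
  have p_cont: "continuous_on {0..1} p"
    unfolding p_def by (intro continuous_intros)
  have "ennreal (c\<^sup>2) \<le> (\<integral>\<^sup>+ t. ennreal ((h' t)\<^sup>2) * indicator {0..1} t
      * indicator {t. c < \<bar>(u \<circ> p) t\<bar> \<and> \<bar>(u \<circ> p) t\<bar> < 2 * c} t \<partial>lborel)"
  proof (rule level_crossing_energy)
    fix t :: real assume t: "t \<in> {0..1}"
    have "(u \<circ> p has_derivative (\<lambda>v. v \<bullet> G (p t)) \<circ> (\<lambda>x. x *\<^sub>R (\<theta> *\<^sub>R (y - z)))) (at t within {0..1})"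
      by (rule diff_chain_within[OF p_deriv has_derivative_at_withinI[OF gderiv[OF p_dom[OF t]]]])
    then show "(u \<circ> p has_real_derivative h' t) (at t within {0..1})"
      unfolding has_field_derivative_def h'_def
      by (rule has_derivative_eq_rhs) (auto simp: fun_eq_iff)
  next
    show "continuous_on {0..1} h'" unfolding h'_def
      by (intro continuous_intros continuous_on_compose2[OF G_cont p_cont]) (use p_dom in auto)
  qed (use top bot c in \<open>auto simp: p_def\<close>)
  also have "\<dots> \<le> (\<integral>\<^sup>+ t. ennreal ((\<theta> * R)\<^sup>2) * (ennreal ((norm (G (p t)))\<^sup>2)
      * indicator (band c) (p t) * indicator {0..1} t) \<partial>lborel)"
  proof (rule nn_integral_mono)
    fix t :: real
    have "\<bar>h' t\<bar> \<le> norm (\<theta> *\<^sub>R (y - z)) * norm (G (p t))"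
      unfolding h'_def by (rule Cauchy_Schwarz_ineq2)
    also have "\<dots> \<le> \<theta> * R * norm (G (p t))"
      using \<theta> diam[OF y z] by (auto intro!: mult_right_mono mult_left_mono)
    finally have "(h' t)\<^sup>2 \<le> (\<theta> * R)\<^sup>2 * (norm (G (p t)))\<^sup>2"
      by (metis abs_ge_zero power2_abs power_mono power_mult_distrib)
    then have "ennreal ((h' t)\<^sup>2) \<le> ennreal ((\<theta> * R)\<^sup>2) * ennreal ((norm (G (p t)))\<^sup>2)"
      by (simp add: ennreal_mult[symmetric] ennreal_leI)
    then show "ennreal ((h' t)\<^sup>2) * indicator {0..1} t
        * indicator {t. c < \<bar>(u \<circ> p) t\<bar> \<and> \<bar>(u \<circ> p) t\<bar> < 2 * c} t
      \<le> ennreal ((\<theta> * R)\<^sup>2) * (ennreal ((norm (G (p t)))\<^sup>2)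
          * indicator (band c) (p t) * indicator {0..1} t)"
      by (auto simp: band_def split: split_indicator)
  qed
  also have "\<dots> = ennreal ((\<theta> * R)\<^sup>2) * (\<integral>\<^sup>+ t. (ennreal ((norm (G (p t)))\<^sup>2)
      * indicator (band c) (p t) * indicator {0..1} t) \<partial>lborel)"
    unfolding p_def by (rule nn_integral_cmult) measurable
  finally show ?thesis unfolding p_def .
qed

text \<open>Every point \<open>z\<close> of the superlevel set has, by \<open>good\<close>, a crossing segment for at least half of all
  directions \<open>y \<in> B\<close>. Averaging the one-dimensional crossing estimate over these \<open>y\<close>, integrating over \<open>z\<close>,
  and exchanging the order of integration leaves, for fixed \<open>y\<close> and fixed time along the segment, an
  integral over contracted points, which \<open>nn_integral_contraction_le\<close> controls.\<close>

lemma superlevel_measure_le_band_energy: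
  assumes \<theta>: "0 < \<theta>" "\<theta> \<le> 1 / 2" and c: "0 < c"
    and good: "\<And>z. z \<in> \<Omega> \<Longrightarrow> 2 * c \<le> \<bar>u z\<bar> \<Longrightarrow>
      emeasure lborel B \<le> 2 * emeasure lborel {y \<in> B. \<bar>u ((1 - \<theta>) *\<^sub>R z + \<theta> *\<^sub>R y)\<bar> \<le> c}"
  shows "ennreal (c\<^sup>2) * emeasure \<mu> {z. 2 * c \<le> \<bar>u z\<bar>} \<le> ennreal (2 * R\<^sup>2 * 2 powr hdim * \<theta>\<^sup>2) *
      (\<integral>\<^sup>+ z. ennreal ((norm (G z))\<^sup>2) * indicator (band c) z \<partial>\<mu>)"
proof -
  define e where "e z = ennreal ((norm (G z))\<^sup>2) * indicator (band c) z" for z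
  have e_meas [measurable]: "e \<in> borel_measurable borel" unfolding e_def by measurable
  define p where "p z y t = (1 - \<theta> * t) *\<^sub>R z + (\<theta> * t) *\<^sub>R y" for z y :: 'a and t :: real
  have [measurable]: "(\<lambda>x. p (f x) (g x) (h x)) \<in> borel_measurable N"
    if [measurable]: "f \<in> borel_measurable N" "g \<in> borel_measurable N" "h \<in> borel_measurable N"
    for f g :: "'x \<Rightarrow> 'a" and h and N unfolding p_def by measurable
  define b where "b = emeasure lborel B"
  have b_fin: "b < \<infinity>" "b \<noteq> 0"
    using emeasure_mono[OF B_dom, of lborel] emeasure_dom_finite B_pos
    by (auto simp: b_def measure_def less_top[symmetric] top_unique)
  let ?S = "{z. 2 * c \<le> \<bar>u z\<bar>}"
  let ?T = "ennreal ((\<theta> * R)\<^sup>2)"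
  have pointwise: "ennreal (c\<^sup>2) * b * indicator ?S z * weight z \<le>
     2 * ?T * (\<integral>\<^sup>+ y. indicator B y * (\<integral>\<^sup>+ t. indicator {0..1} t * (weight z * e (p z y t)) \<partial>lborel) \<partial>lborel)" for z
  proof (cases "z \<in> \<Omega> \<and> z \<in> ?S")
    case True
    let ?H = "{y \<in> B. \<bar>u ((1 - \<theta>) *\<^sub>R z + \<theta> *\<^sub>R y)\<bar> \<le> c}"
    have "ennreal (c\<^sup>2) * b \<le> ennreal (c\<^sup>2) * (2 * emeasure lborel ?H)"
      using good[of z] True unfolding b_def by (intro mult_left_mono) auto
    also have "\<dots> = 2 * (\<integral>\<^sup>+ y. ennreal (c\<^sup>2) * indicator ?H y \<partial>lborel)"
      by (subst nn_integral_cmult_indicator) (auto simp: mult_ac)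
    also have "\<dots> \<le> 2 * (\<integral>\<^sup>+ y. ?T * (indicator B y * (\<integral>\<^sup>+ t. indicator {0..1} t * e (p z y t) \<partial>lborel)) \<partial>lborel)"
    proof (intro mult_left_mono nn_integral_mono)
      fix y
      show "ennreal (c\<^sup>2) * indicator ?H y \<le> ?T * (indicator B y * (\<integral>\<^sup>+ t. indicator {0..1} t * e (p z y t) \<partial>lborel))"
        using level_crossing_on_segment[of z y \<theta> c] True B_dom \<theta> c
        by (auto simp: e_def p_def mult_ac split: split_indicator)
    qed auto
    also have "\<dots> = 2 * ?T * (\<integral>\<^sup>+ y. indicator B y * (\<integral>\<^sup>+ t. indicator {0..1} t * e (p z y t) \<partial>lborel) \<partial>lborel)"
      by (subst nn_integral_cmult) (auto simp: mult_ac)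
    finally have "weight z * (ennreal (c\<^sup>2) * b) \<le>
      weight z * (2 * ?T * (\<integral>\<^sup>+ y. indicator B y * (\<integral>\<^sup>+ t. indicator {0..1} t * e (p z y t) \<partial>lborel) \<partial>lborel))"
      by (rule mult_left_mono) auto
    also have "\<dots> = 2 * ?T * (\<integral>\<^sup>+ y. indicator B y * (\<integral>\<^sup>+ t. indicator {0..1} t * (weight z * e (p z y t)) \<partial>lborel) \<partial>lborel)"
      by (simp add: nn_integral_cmult[symmetric] mult_ac)
    finally show ?thesis using True by (simp add: mult_ac)
  qed (auto simp: weight_def)
  have "b * (ennreal (c\<^sup>2) * emeasure \<mu> ?S) = (\<integral>\<^sup>+ z. ennreal (c\<^sup>2) * b * indicator ?S z * weight z \<partial>lborel)"
    unfolding \<mu>_def by (simp add: emeasure_density nn_integral_cmult[symmetric] mult_ac)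
  also have "\<dots> \<le> (\<integral>\<^sup>+ z. 2 * ?T * (\<integral>\<^sup>+ y. indicator B y * (\<integral>\<^sup>+ t. indicator {0..1} t * (weight z * e (p z y t)) \<partial>lborel) \<partial>lborel) \<partial>lborel)"
    by (intro nn_integral_mono pointwise)
  also have "\<dots> = 2 * ?T * (\<integral>\<^sup>+ y. (\<integral>\<^sup>+ z. indicator B y * (\<integral>\<^sup>+ t. indicator {0..1} t * (weight z * e (p z y t)) \<partial>lborel) \<partial>lborel) \<partial>lborel)"
    by (subst nn_integral_cmult) (auto intro!: arg_cong2[where f="(*)"] lborel_pair.Fubini')
  also have "\<dots> = 2 * ?T * (\<integral>\<^sup>+ y. indicator B y * (\<integral>\<^sup>+ t. \<integral>\<^sup>+ z. indicator {0..1} t * (weight z * e (p z y t)) \<partial>lborel \<partial>lborel) \<partial>lborel)"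
    by (subst nn_integral_cmult) (auto intro!: arg_cong2[where f="(*)"] nn_integral_cong lborel_pair.Fubini')
  also have "\<dots> \<le> 2 * ?T * (\<integral>\<^sup>+ y. indicator B y * (\<integral>\<^sup>+ t. ennreal (2 powr hdim) * (\<integral>\<^sup>+ z. e z \<partial>\<mu>) * indicator {0..1::real} t \<partial>lborel) \<partial>lborel)"
  proof -
    have "indicator B y * (\<integral>\<^sup>+ t. \<integral>\<^sup>+ z. indicator {0..1} t * (weight z * e (p z y t)) \<partial>lborel \<partial>lborel)
      \<le> indicator B y * (\<integral>\<^sup>+ t. ennreal (2 powr hdim) * (\<integral>\<^sup>+ z. e z \<partial>\<mu>) * indicator {0..1::real} t \<partial>lborel)" for y
    proof (cases "y \<in> B")
      case True
      have "(\<integral>\<^sup>+ z. indicator {0..1} t * (weight z * e (p z y t)) \<partial>lborel)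
        \<le> ennreal (2 powr hdim) * (\<integral>\<^sup>+ z. e z \<partial>\<mu>) * indicator {0..1::real} t" for t
      proof (cases "t \<in> {0..1}")
        case t: True
        have "\<theta> * t \<le> 1 / 2 * 1" using t \<theta> by (intro mult_mono) auto
        then show ?thesis
          using nn_integral_contraction_le[of e "\<theta> * t" y] True B_dom t \<theta> by (auto simp: p_def)
      qed auto
      then show ?thesis by (intro mult_left_mono nn_integral_mono) auto
    qed auto
    from nn_integral_mono[OF this] show ?thesis by (intro mult_left_mono) auto
  qed
  also have "\<dots> = 2 * ?T * (ennreal (2 powr hdim) * (\<integral>\<^sup>+ z. e z \<partial>\<mu>) * b)"
  proof -
    have "(\<integral>\<^sup>+ t. ennreal (2 powr hdim) * (\<integral>\<^sup>+ z. e z \<partial>\<mu>) * indicator {0..1::real} t \<partial>lborel)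
        = ennreal (2 powr hdim) * (\<integral>\<^sup>+ z. e z \<partial>\<mu>)"
      by (subst nn_integral_cmult_indicator) auto
    moreover have "(\<integral>\<^sup>+ y. indicator B y * x \<partial>lborel) = x * b" for x
      unfolding b_def by (subst mult.commute, subst nn_integral_cmult_indicator) auto
    ultimately show ?thesis by simp
  qed
  also have "\<dots> = b * (ennreal (2 * R\<^sup>2 * 2 powr hdim * \<theta>\<^sup>2) * (\<integral>\<^sup>+ z. e z \<partial>\<mu>))"
  proof -
    have "ennreal (2 * R\<^sup>2 * 2 powr hdim * \<theta>\<^sup>2) = ennreal (2 * ((\<theta> * R)\<^sup>2 * 2 powr hdim))"
      by (simp add: power_mult_distrib mult_ac)
    also have "\<dots> = 2 * (?T * ennreal (2 powr hdim))"
      by (simp only: ennreal_mult zero_le_power2 powr_ge_zero zero_le_numeral mult_nonneg_nonneg ennreal_numeral)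
    finally have "ennreal (2 * R\<^sup>2 * 2 powr hdim * \<theta>\<^sup>2) = 2 * (?T * ennreal (2 powr hdim))" .
    then show ?thesis by (simp add: mult_ac)
  qed
  finally have "b * (ennreal (c\<^sup>2) * emeasure \<mu> ?S) \<le> b * (ennreal (2 * R\<^sup>2 * 2 powr hdim * \<theta>\<^sup>2) * (\<integral>\<^sup>+ z. e z \<partial>\<mu>))" .
  then show ?thesis using b_fin unfolding e_def by (subst (asm) ennreal_mult_le_mult_iff) auto
qed

text \<open>The parameter \<open>\<theta>\<close> is as small as possible under the requirement that at most half of \<open>B\<close> is sent into
  \<open>{\<bar>u\<bar> \<ge> c}\<close>; by \<open>emeasure_contraction_preimage_le\<close> this holds once \<open>\<theta>\<close> to the power \<open>hdim\<close>
  reaches a fixed multiple of the measure of that set. If this would force \<open>\<theta>\<close> above \<open>1/2\<close>, then \<open>\<theta> = 1/2\<close> does, because the midpoints are zeros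
  of \<open>u\<close>.\<close>

lemma superlevel_decay:
  assumes c: "0 < c" and \<delta>: "0 \<le> \<delta>" "\<delta> * hdim \<le> 2"
  shows "ennreal (c\<^sup>2) * emeasure \<mu> {z. 2 * c \<le> \<bar>u z\<bar>} \<le>
    ennreal (decay_const \<delta> * measure \<mu> {z. c \<le> \<bar>u z\<bar>} powr \<delta>) *
      (\<integral>\<^sup>+ z. ennreal ((norm (G z))\<^sup>2) * indicator (band c) z \<partial>\<mu>)"
proof -
  interpret finite_measure \<mu> by (rule finite_measure_\<mu>)
  let ?A = "{z. c \<le> \<bar>u z\<bar>}" and ?E = "\<integral>\<^sup>+ z. ennreal ((norm (G z))\<^sup>2) * indicator (band c) z \<partial>\<mu>"
  define a where "a = measure \<mu> ?A"
  have a: "emeasure \<mu> ?A = ennreal a" unfolding a_def by (simp add: emeasure_eq_measure)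
  define b where "b = measure lborel B"
  have "emeasure lborel B < \<infinity>"
    using emeasure_mono[OF B_dom, of lborel] emeasure_dom_finite by auto
  then have b: "emeasure lborel B = ennreal b" unfolding b_def
    by (intro emeasure_eq_ennreal_measure) auto
  have b_pos: "0 < b" using B_pos by (simp add: b_def)
  have hdim_pos: "0 < hdim" using k_nonneg by (simp add: hdim_def add_pos_nonneg)
  show ?thesis
  proof (cases "a = 0")
    case True
    have "emeasure \<mu> {z. 2 * c \<le> \<bar>u z\<bar>} \<le> emeasure \<mu> ?A"
      using c by (intro emeasure_mono) auto
    then show ?thesis using a True by simp
  next
    case False
    then have a_pos: "0 < a" by (simp add: a_def zero_less_measure_iff)
    \<comment> \<open>With \<open>\<theta>\<close> to the power \<open>hdim\<close> equal to \<open>L a\<close>, the bad part of \<open>B\<close> has measure at most \<open>b / 2\<close>.\<close>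
    define L where "L = 2 * 2 powr k / b"
    have L_pos: "0 < L" using b_pos by (simp add: L_def)
    define \<theta> where "\<theta> = min (1 / 2) ((L * a) powr (1 / hdim))"
    have \<theta>: "0 < \<theta>" "\<theta> \<le> 1 / 2" using a_pos L_pos by (auto simp: \<theta>_def)
    have "ennreal (c\<^sup>2) * emeasure \<mu> {z. 2 * c \<le> \<bar>u z\<bar>} \<le> ennreal (2 * R\<^sup>2 * 2 powr hdim * \<theta>\<^sup>2) * ?E"
    proof (rule superlevel_measure_le_band_energy[OF \<theta> c])
      fix z assume z: "z \<in> \<Omega>" "2 * c \<le> \<bar>u z\<bar>"
      let ?H = "{y \<in> B. \<bar>u ((1 - \<theta>) *\<^sub>R z + \<theta> *\<^sub>R y)\<bar> \<le> c}"
      let ?F = "{y \<in> B. (1 - \<theta>) *\<^sub>R z + \<theta> *\<^sub>R y \<in> ?A}"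
      show "emeasure lborel B \<le> 2 * emeasure lborel ?H"
      proof (cases "(L * a) powr (1 / hdim) < 1 / 2")
        case True
        then have "\<theta> powr (- hdim) = inverse (L * a)"
          using a_pos L_pos hdim_pos by (simp add: \<theta>_def powr_powr powr_minus)
        then have "emeasure lborel ?F \<le> ennreal (2 powr k * inverse (L * a)) * emeasure \<mu> ?A"
          using emeasure_contraction_preimage_le[of ?A \<theta> z] \<theta> z by simp
        also have "\<dots> = ennreal (b / 2)"
          using a_pos b_pos by (simp add: a L_def ennreal_mult[symmetric] field_simps)
        finally have F: "emeasure lborel ?F \<le> ennreal (b / 2)" .
        have "ennreal b \<le> emeasure lborel (?H \<union> ?F)"
          unfolding b[symmetric] by (intro emeasure_mono) auto
        also have "\<dots> \<le> emeasure lborel ?H + emeasure lborel ?F"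
          by (intro emeasure_subadditive) auto
        also have "\<dots> \<le> emeasure lborel ?H + ennreal (b / 2)"
          using F by (intro add_left_mono)
        finally have *: "ennreal b \<le> emeasure lborel ?H + ennreal (b / 2)" .
        show ?thesis
        proof (cases "emeasure lborel ?H")
          case (real h)
          then have "ennreal b \<le> ennreal (h + b / 2)" using * b_pos by simp
          then have "b \<le> h + b / 2" using real b_pos by (subst (asm) ennreal_le_iff) auto
          then have "b \<le> 2 * h" by simp
          then have "ennreal b \<le> ennreal (2 * h)" by (rule ennreal_leI)
          then show ?thesis using real b by (simp add: ennreal_mult)
        qed simp
      next
        \<comment> \<open>All midpoints are zeros of \<open>u\<close>, so the whole of \<open>B\<close> is good.\<close>
        case False
        then have "\<theta> = 1 / 2" by (simp add: \<theta>_def)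
        then have "?H = B" using midpoint_zero[OF z(1)] z(2) c by force
        then show ?thesis
          using mult_right_mono[of 1 "2::ennreal" "emeasure lborel B"] by simp
      qed
    qed
    also have "\<dots> \<le> ennreal (decay_const \<delta> * a powr \<delta>) * ?E"
    proof (intro mult_right_mono ennreal_leI)
      \<comment> \<open>Since \<open>\<theta> \<le> 1\<close>, the exponent \<open>2\<close> may be lowered to \<open>\<delta>\<close> times \<open>hdim\<close>.\<close>
      have "\<theta>\<^sup>2 = \<theta> powr 2" using \<theta> by (simp add: powr_numeral)
      also have "\<dots> \<le> \<theta> powr (\<delta> * hdim)" using \<theta> \<delta> by (intro powr_mono') auto
      also have "\<dots> \<le> ((L * a) powr (1 / hdim)) powr (\<delta> * hdim)"
        using \<theta> \<delta> hdim_pos by (intro powr_mono2) (auto simp: \<theta>_def)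
      also have "\<dots> = L powr \<delta> * a powr \<delta>"
        using hdim_pos L_pos a_pos by (simp add: powr_powr powr_mult)
      finally have "2 * R\<^sup>2 * 2 powr hdim * \<theta>\<^sup>2 \<le> 2 * R\<^sup>2 * 2 powr hdim * (L powr \<delta> * a powr \<delta>)"
        by (intro mult_left_mono) auto
      then show "2 * R\<^sup>2 * 2 powr hdim * \<theta>\<^sup>2 \<le> decay_const \<delta> * a powr \<delta>"
        by (simp add: decay_const_def L_def b_def mult_ac)
    qed simp
    finally show ?thesis unfolding a_def .
  qed
qed

subsection \<open>Summation over dyadic levels\<close>

lemma disjoint_bands:
  assumes "0 < c"
  shows "disjoint_family (\<lambda>i::nat. band (c * 2 ^ i))"
proof -
  have "band (c * 2 ^ i) \<inter> band (c * 2 ^ j) = {}" if "i < j" for i j :: nat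
  proof -
    have "(2::real) ^ Suc i \<le> 2 ^ j" using that by (intro power_increasing) auto
    then have "2 * (c * 2 ^ i) \<le> c * 2 ^ j" using assms by simp
    then show ?thesis by (auto simp: band_def)
  qed
  then show ?thesis unfolding disjoint_family_on_def
    by (metis Int_commute linorder_neqE_nat)
qed

text \<open>Discretising \<open>\<bar>u\<bar>\<close> along the levels \<open>c 2\<^sup>i\<close> and applying \<open>superlevel_decay\<close> at each of them. With
  \<open>\<delta> = 1 - 2 / P\<close> the powers of the level combine to \<open>(x\<^sup>P \<mu>{\<bar>u\<bar> \<ge> x})\<^sup>\<delta>\<close>, which Markov's inequality
  bounds by \<open>I\<^sup>\<delta>\<close>. Values below \<open>2 c\<close> are absorbed in the first summand, which vanishes as \<open>c\<close> tends to
  zero.\<close>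

lemma sobolev_recursive:
  assumes P: "2 \<le> P" "(1 - 2 / P) * hdim \<le> 2" and I: "(\<integral>\<^sup>+ z. ennreal (\<bar>u z\<bar> powr P) \<partial>\<mu>) = ennreal I" "0 \<le> I"
    and c: "0 < c"
  shows "ennreal I \<le> ennreal ((2 * c) powr P * measure \<mu> UNIV)
    + ennreal (4 powr P * decay_const (1 - 2 / P) * I powr (1 - 2 / P)) * (\<integral>\<^sup>+ z. ennreal ((norm (G z))\<^sup>2) \<partial>\<mu>)"
proof -
  interpret finite_measure \<mu> by (rule finite_measure_\<mu>)
  define \<delta> where "\<delta> = 1 - 2 / P"
  have \<delta>: "0 \<le> \<delta>" "\<delta> * hdim \<le> 2" using P by (auto simp: \<delta>_def)
  have decay_const_nonneg: "0 \<le> decay_const \<delta>" by (simp add: decay_const_def)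
  define l where "l i = c * 2 ^ i" for i :: nat
  have l: "0 < l i" for i using c by (simp add: l_def)
  define S where "S x = {z. x \<le> \<bar>u z\<bar>}" for x
  have [measurable]: "S x \<in> sets borel" for x unfolding S_def by measurable
  define \<nu> where "\<nu> = density \<mu> (\<lambda>z. ennreal ((norm (G z))\<^sup>2))"
  have \<nu>: "emeasure \<nu> (band x) = (\<integral>\<^sup>+ z. ennreal ((norm (G z))\<^sup>2) * indicator (band x) z \<partial>\<mu>)" for x
    unfolding \<nu>_def by (rule emeasure_density) auto
  have markov: "x powr P * measure \<mu> (S x) \<le> I" if "0 < x" for x
  proof -
    have "ennreal (x powr P) * emeasure \<mu> (S x) = (\<integral>\<^sup>+ z. ennreal (x powr P) * indicator (S x) z \<partial>\<mu>)"
      by (subst nn_integral_cmult_indicator) auto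
    also have "\<dots> \<le> (\<integral>\<^sup>+ z. ennreal (\<bar>u z\<bar> powr P) \<partial>\<mu>)"
      using that P by (intro nn_integral_mono)
        (auto simp: S_def split: split_indicator intro!: ennreal_leI powr_mono2)
    finally show ?thesis using I by (simp add: emeasure_eq_measure ennreal_mult[symmetric])
  qed
  have level: "ennreal ((4 * x) powr P) * emeasure \<mu> (S (2 * x)) \<le> ennreal (4 powr P * decay_const \<delta> * I powr \<delta>) * emeasure \<nu> (band x)"
    if x: "0 < x" for x
  proof -
    define a where "a = measure \<mu> (S x)"
    have a: "0 \<le> a" "x powr P * a \<le> I" using markov[OF x] by (auto simp: a_def)
    have "(4 * x) powr P = 4 powr P * x powr (P - 2) * x\<^sup>2"
      using x by (simp add: powr_mult powr_diff powr_numeral)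
    then have "ennreal ((4 * x) powr P) * emeasure \<mu> (S (2 * x)) =
        ennreal (4 powr P * x powr (P - 2)) * (ennreal (x\<^sup>2) * emeasure \<mu> (S (2 * x)))"
      by (simp add: ennreal_mult mult.assoc)
    also have "\<dots> \<le> ennreal (4 powr P * x powr (P - 2)) * (ennreal (decay_const \<delta> * a powr \<delta>) * emeasure \<nu> (band x))"
      using superlevel_decay[OF x \<delta>] by (intro mult_left_mono) (auto simp: \<nu> S_def a_def)
    also have "\<dots> = ennreal (4 powr P * decay_const \<delta> * (x powr (P - 2) * a powr \<delta>)) * emeasure \<nu> (band x)"
      using decay_const_nonneg by (simp add: ennreal_mult mult_ac)
    also have "\<dots> \<le> ennreal (4 powr P * decay_const \<delta> * I powr \<delta>) * emeasure \<nu> (band x)"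
    proof (intro mult_right_mono ennreal_leI mult_left_mono)
      have "x powr (P - 2) = (x powr P) powr \<delta>" using P by (simp add: powr_powr \<delta>_def right_diff_distrib)
      then have "x powr (P - 2) * a powr \<delta> = (x powr P * a) powr \<delta>" using a by (simp add: powr_mult)
      also have "\<dots> \<le> I powr \<delta>" using a \<delta> by (intro powr_mono2) auto
      finally show "x powr (P - 2) * a powr \<delta> \<le> I powr \<delta>" .
    qed (use decay_const_nonneg in auto)
    finally show ?thesis .
  qed
  have pointwise: "ennreal (\<bar>u z\<bar> powr P) \<le> ennreal ((2 * c) powr P)
      + (\<Sum>i. ennreal ((4 * l i) powr P) * indicator (S (2 * l i)) z)" for z
  proof (cases "2 * c \<le> \<bar>u z\<bar>")
    case True
    then obtain i where i: "2 * c * 2 ^ i \<le> \<bar>u z\<bar>" "\<bar>u z\<bar> < 2 * (2 * c * 2 ^ i)"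
      using dyadic_level[of "2 * c" "\<bar>u z\<bar>"] c by auto
    have "ennreal (\<bar>u z\<bar> powr P) \<le> ennreal ((4 * l i) powr P) * indicator (S (2 * l i)) z"
      using i P by (auto simp: S_def l_def mult_ac intro!: ennreal_leI powr_mono2)
    also have "\<dots> \<le> (\<Sum>i. ennreal ((4 * l i) powr P) * indicator (S (2 * l i)) z)"
    proof -
      have "sum f {i} \<le> suminf f" for f :: "nat \<Rightarrow> ennreal" by (rule sum_le_suminf) auto
      then show ?thesis by simp
    qed
    finally show ?thesis by (rule add_increasing[OF zero_le])
  next
    case False
    then show ?thesis using P by (intro add_increasing2 ennreal_leI powr_mono2) auto
  qed
  have "ennreal I \<le> (\<integral>\<^sup>+ z. ennreal ((2 * c) powr P)
      + (\<Sum>i. ennreal ((4 * l i) powr P) * indicator (S (2 * l i)) z) \<partial>\<mu>)"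
    unfolding I(1)[symmetric] by (intro nn_integral_mono pointwise)
  also have "\<dots> = ennreal ((2 * c) powr P * measure \<mu> UNIV) + (\<Sum>i. ennreal ((4 * l i) powr P) * emeasure \<mu> (S (2 * l i)))"
    by (simp add: nn_integral_add nn_integral_suminf nn_integral_cmult_indicator emeasure_eq_measure ennreal_mult)
  also have "\<dots> \<le> ennreal ((2 * c) powr P * measure \<mu> UNIV) + (\<Sum>i. ennreal (4 powr P * decay_const \<delta> * I powr \<delta>) * emeasure \<nu> (band (l i)))"
    by (intro add_left_mono suminf_le level l) auto
  also have "\<dots> = ennreal ((2 * c) powr P * measure \<mu> UNIV) + ennreal (4 powr P * decay_const \<delta> * I powr \<delta>) * emeasure \<nu> (\<Union>i. band (l i))"
    using disjoint_bands[OF c] unfolding l_def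
    by (subst suminf_emeasure[symmetric]) (auto simp: \<nu>_def ennreal_suminf_cmult)
  also have "\<dots> \<le> ennreal ((2 * c) powr P * measure \<mu> UNIV) + ennreal (4 powr P * decay_const \<delta> * I powr \<delta>) * emeasure \<nu> UNIV"
    by (intro add_left_mono mult_left_mono emeasure_mono) (auto simp: \<nu>_def)
  also have "emeasure \<nu> UNIV = (\<integral>\<^sup>+ z. ennreal ((norm (G z))\<^sup>2) \<partial>\<mu>)"
    unfolding \<nu>_def by (subst emeasure_density) auto
  finally show ?thesis unfolding \<delta>_def .
qed

text \<open>Boundedness of \<open>u\<close> makes \<open>I\<close> finite, which is what permits the division by \<open>I\<^sup>\<delta>\<close>.\<close>

theorem sobolev:
  assumes P: "2 \<le> P" "(1 - 2 / P) * hdim \<le> 2" and bdd: "\<And>z. z \<in> \<Omega> \<Longrightarrow> \<bar>u z\<bar> \<le> b"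
  shows "ennreal (enn2real (\<integral>\<^sup>+ z. ennreal (\<bar>u z\<bar> powr P) \<partial>\<mu>) powr (2 / P)) \<le>
    ennreal (4 powr P * decay_const (1 - 2 / P)) * (\<integral>\<^sup>+ z. ennreal ((norm (G z))\<^sup>2) \<partial>\<mu>)"
proof -
  interpret finite_measure \<mu> by (rule finite_measure_\<mu>)
  define I where "I = enn2real (\<integral>\<^sup>+ z. ennreal (\<bar>u z\<bar> powr P) \<partial>\<mu>)"
  define \<delta> where "\<delta> = 1 - 2 / P"
  have "(\<integral>\<^sup>+ z. ennreal (\<bar>u z\<bar> powr P) \<partial>\<mu>) \<le> (\<integral>\<^sup>+ z. ennreal (b powr P) \<partial>\<mu>)"
  proof -
    have "weight z * ennreal (\<bar>u z\<bar> powr P) \<le> weight z * ennreal (b powr P)" for z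
      using P bdd[of z] by (cases "z \<in> \<Omega>")
        (auto simp: weight_def intro!: mult_left_mono ennreal_leI powr_mono2)
    then show ?thesis by (subst (1 2) nn_integral_\<mu>) (auto intro!: nn_integral_mono)
  qed
  also have "\<dots> < \<infinity>" by (simp add: emeasure_eq_measure ennreal_mult_less_top)
  finally have I: "(\<integral>\<^sup>+ z. ennreal (\<bar>u z\<bar> powr P) \<partial>\<mu>) = ennreal I" "0 \<le> I"
    by (auto simp: I_def)
  have decay_const_pos: "0 \<le> decay_const \<delta>" by (simp add: decay_const_def)
  have "ennreal (I powr (2 / P)) \<le> ennreal (4 powr P * decay_const \<delta>) * (\<integral>\<^sup>+ z. ennreal ((norm (G z))\<^sup>2) \<partial>\<mu>)"
  proof (cases "I = 0")
    case False
    then have I_pos: "0 < I" using I by simp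
    have lim: "((\<lambda>c. ennreal ((2 * c) powr P * measure \<mu> UNIV)
      + ennreal (4 powr P * decay_const \<delta> * I powr \<delta>) * (\<integral>\<^sup>+ z. ennreal ((norm (G z))\<^sup>2) \<partial>\<mu>)) \<longlongrightarrow>
      ennreal ((2 * 0) powr P * measure \<mu> UNIV)
      + ennreal (4 powr P * decay_const \<delta> * I powr \<delta>) * (\<integral>\<^sup>+ z. ennreal ((norm (G z))\<^sup>2) \<partial>\<mu>)) (at_right 0)"
    proof -
      have "((\<lambda>c. (2 * c) powr P) \<longlongrightarrow> (2 * 0) powr P) (at_right 0)"
        using P by (intro tendsto_powr2 tendsto_intros) (auto simp: eventually_at_right_field intro!: exI[of _ 1])
      then show ?thesis by (intro tendsto_add tendsto_ennrealI tendsto_mult tendsto_const)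
    qed
    have "ennreal I \<le> ennreal ((2 * 0) powr P * measure \<mu> UNIV)
      + ennreal (4 powr P * decay_const \<delta> * I powr \<delta>) * (\<integral>\<^sup>+ z. ennreal ((norm (G z))\<^sup>2) \<partial>\<mu>)"
    proof (rule tendsto_lowerbound[OF lim])
      show "\<forall>\<^sub>F c in at_right 0. ennreal I \<le> ennreal ((2 * c) powr P * measure \<mu> UNIV)
        + ennreal (4 powr P * decay_const \<delta> * I powr \<delta>) * (\<integral>\<^sup>+ z. ennreal ((norm (G z))\<^sup>2) \<partial>\<mu>)"
        using sobolev_recursive[OF P I] unfolding \<delta>_def
        by (auto simp: eventually_at_right_field intro!: exI[of _ 1])
    qed simp
    moreover have "I powr (2 / P) = I powr (- \<delta>) * I"
      using I_pos by (simp add: \<delta>_def powr_diff powr_minus field_simps)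
    ultimately have "ennreal (I powr (2 / P)) \<le>
        ennreal (I powr (- \<delta>)) * (ennreal (4 powr P * decay_const \<delta> * I powr \<delta>) * (\<integral>\<^sup>+ z. ennreal ((norm (G z))\<^sup>2) \<partial>\<mu>))"
      using P I by (simp add: ennreal_mult mult_left_mono)
    also have "\<dots> = ennreal (I powr (- \<delta>) * (4 powr P * decay_const \<delta> * I powr \<delta>)) * (\<integral>\<^sup>+ z. ennreal ((norm (G z))\<^sup>2) \<partial>\<mu>)"
      by (subst ennreal_mult) (use decay_const_pos in \<open>auto simp: mult.assoc\<close>)
    also have "I powr (- \<delta>) * (4 powr P * decay_const \<delta> * I powr \<delta>) = 4 powr P * decay_const \<delta>"
      using I_pos by (simp add: powr_minus field_simps)
    finally show ?thesis .
  qed simp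
  then show ?thesis unfolding I_def \<delta>_def .
qed

end

section \<open>Gradients of test functions\<close>

text \<open>Extension by zero is harmless: off the support \<open>f\<close> vanishes on an open set, so \<open>f\<close> is continuously
  differentiable on the whole space, not only on \<open>U\<close>.\<close>

lemma test_function_gradient:
  fixes f :: "'a::euclidean_space \<Rightarrow> real"
  assumes f: "f \<in> test_functions U" and U: "open U"
  obtains G where "\<And>z. (f has_derivative (\<lambda>h. h \<bullet> G z)) (at z)" "continuous_on UNIV G"
    "\<And>z. z \<notin> closure {z. f z \<noteq> 0} \<Longrightarrow> G z = 0"
proof -
  define S where "S = closure {z. f z \<noteq> 0}"
  have S: "compact S" "S \<subseteq> U" and C1: "Ck_on (Suc 0) U f"
    using f unfolding test_functions_def S_def by blast+
  define G where "G z = (\<Sum>b\<in>Basis. frechet_derivative f (at z) b *\<^sub>R b)" for z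
  have inner_G: "h \<bullet> G z = F h" if F: "(f has_derivative F) (at z)" for F h z
  proof -
    interpret F: bounded_linear F using F by (rule has_derivative_bounded_linear)
    have "F h = F (\<Sum>b\<in>Basis. (h \<bullet> b) *\<^sub>R b)" by (simp add: euclidean_representation)
    also have "\<dots> = (\<Sum>b\<in>Basis. (h \<bullet> b) * F b)" by (simp add: F.sum F.scaleR)
    also have "\<dots> = h \<bullet> G z"
      by (simp add: G_def inner_sum_right frechet_derivative_at[OF F, symmetric] mult.commute)
    finally show ?thesis by simp
  qed
  have zero: "(f has_derivative (\<lambda>_. 0)) (at z)" if "z \<notin> S" for z
  proof (rule has_derivative_transform_within_open[of "\<lambda>_. 0" _ _ _ "- S"])
    show "open (- S)" by (simp add: S_def open_Compl)
    fix y assume "y \<in> - S"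
    then show "0 = f y" using closure_subset[of "{z. f z \<noteq> 0}"] by (auto simp: S_def)
  qed (use that in auto)
  have G0: "G z = 0" if "z \<notin> S" for z
    using inner_G[OF zero[OF that], of "G z"] by simp
  have deriv: "(f has_derivative (\<lambda>h. h \<bullet> G z)) (at z)" for z
  proof (cases "z \<in> U")
    case True
    then have "f differentiable (at z)" using C1 by simp
    then obtain F where F: "(f has_derivative F) (at z)" unfolding differentiable_def by blast
    moreover have "F = (\<lambda>h. h \<bullet> G z)" using inner_G[OF F] by (intro ext) simp
    ultimately show ?thesis by simp
  next
    case False
    then have "z \<notin> S" using S by auto
    then show ?thesis using zero[of z] G0[of z] by simp
  qed
  have "continuous_on U G" using C1 unfolding G_def
    by (intro continuous_intros) auto
  moreover have "continuous_on (- S) G"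
    by (rule continuous_on_eq[of _ "\<lambda>_. 0"]) (auto simp: G0)
  ultimately have "continuous_on (U \<union> - S) G"
    using U by (intro continuous_on_open_Un) (auto simp: S_def)
  moreover have "U \<union> - S = UNIV" using S by auto
  ultimately have "continuous_on UNIV G" by simp
  then show ?thesis using that[OF deriv] G0 unfolding S_def by blast
qed

lemma partial_gradient:
  fixes f :: "('a::euclidean_space \<times> real) \<Rightarrow> real"
  assumes f: "(f has_derivative (\<lambda>h. h \<bullet> g)) (at (x, l))"
  shows "gradient (\<lambda>y. f (y, l)) x = fst g" and "deriv (\<lambda>s. f (x, s)) l = snd g"
proof -
  have "(f \<circ> (\<lambda>y. (y, l)) has_derivative (\<lambda>h. h \<bullet> g) \<circ> (\<lambda>h. (h, 0))) (at x)"
    using f by (intro diff_chain_at) (auto intro!: derivative_eq_intros)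
  then have 1: "GDERIV (\<lambda>y. f (y, l)) x :> fst g"
    unfolding gderiv_def by (simp add: o_def inner_prod_def)
  show "gradient (\<lambda>y. f (y, l)) x = fst g" unfolding gradient_def
  proof (rule the_equality[where P="\<lambda>D. GDERIV (\<lambda>y. f (y, l)) x :> D", OF 1])
    fix D assume "GDERIV (\<lambda>y. f (y, l)) x :> D"
    then have "(\<lambda>h. h \<bullet> D) = (\<lambda>h. h \<bullet> fst g)"
      using 1 unfolding gderiv_def by (rule has_derivative_unique)
    then show "D = fst g" by (metis inner_commute vector_eq_ldot)
  qed
  have "(f \<circ> (\<lambda>s. (x, s)) has_derivative (\<lambda>h. h \<bullet> g) \<circ> (\<lambda>h. (0, h))) (at l)"
    using f by (intro diff_chain_at) (auto intro!: derivative_eq_intros)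
  then have "((\<lambda>s. f (x, s)) has_real_derivative snd g) (at l)"
    unfolding has_field_derivative_def by (simp add: o_def inner_prod_def mult_commute_abs)
  then show "deriv (\<lambda>s. f (x, s)) l = snd g" by (rule DERIV_imp_deriv)
qed

section \<open>The chart that removes the anisotropy\<close>

text \<open>The odd chart with \<open>1 - \<bar>chart q p\<bar> = (1 - \<bar>p\<bar>)\<^sup>q\<close>; as the odd extension of a function that vanishes at
  zero and is smooth there from the right, it is continuously differentiable across \<open>p = 0\<close>, so the two halves of the cylinder need not be treated separately.\<close>

definition chart :: "real \<Rightarrow> real \<Rightarrow> real" where
  "chart q p = sgn p * (1 - (1 - \<bar>p\<bar>) powr q)"

definition dchart :: "real \<Rightarrow> real \<Rightarrow> real" where
  "dchart q p = q * (1 - \<bar>p\<bar>) powr (q - 1)"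

lemma chart_measurable [measurable]: "chart q \<in> borel_measurable borel" "dchart q \<in> borel_measurable borel"
  unfolding chart_def dchart_def by measurable

lemma continuous_on_dchart: "continuous_on {-1<..<1} (dchart q)"
  unfolding dchart_def by (intro continuous_intros) auto

lemma chart_has_derivative:
  assumes p: "p \<in> {-1<..<1}"
  shows "(chart q has_real_derivative dchart q p) (at p)"
proof -
  have pos: "((\<lambda>p. 1 - (1 - p) powr q) has_real_derivative q * (1 - p) powr (q - 1)) (at p)"
    if "p < 1" for p
    using that by (auto intro!: derivative_eq_intros)
  have neg: "((\<lambda>p. (1 + p) powr q - 1) has_real_derivative q * (1 + p) powr (q - 1)) (at p)"
    if "- 1 < p" for p
    using that by (auto intro!: derivative_eq_intros)
  consider "0 < p" | "p < 0" | "p = 0" by linarith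
  then show ?thesis
  proof cases
    case 1
    then have "(chart q has_real_derivative q * (1 - p) powr (q - 1)) (at p)" using p
      by (intro has_field_derivative_transform_within_open[OF pos, of _ "{0<..}"]) (auto simp: chart_def)
    then show ?thesis using 1 by (simp add: dchart_def)
  next
    case 2
    then have "(chart q has_real_derivative q * (1 + p) powr (q - 1)) (at p)" using p
      by (intro has_field_derivative_transform_within_open[OF neg, of _ "{..<0}"]) (auto simp: chart_def)
    then show ?thesis using 2 by (simp add: dchart_def)
  next
    case 3
    have "((\<lambda>y. (chart q y - chart q 0) / (y - 0)) \<longlongrightarrow> q) (at_right 0)"
    proof (rule Lim_transform_eventually)
      show "((\<lambda>y. (1 - (1 - y) powr q - (1 - (1 - 0) powr q)) / (y - 0)) \<longlongrightarrow> q) (at_right 0)"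
        using has_field_derivative_at_within[OF pos[of 0], of "{0<..}"]
        unfolding has_field_derivative_iff by simp
    qed (auto simp: chart_def eventually_at_filter)
    moreover have "((\<lambda>y. (chart q y - chart q 0) / (y - 0)) \<longlongrightarrow> q) (at_left 0)"
    proof (rule Lim_transform_eventually)
      show "((\<lambda>y. ((1 + y) powr q - 1 - ((1 + 0) powr q - 1)) / (y - 0)) \<longlongrightarrow> q) (at_left 0)"
        using has_field_derivative_at_within[OF neg[of 0], of "{..<0}"]
        unfolding has_field_derivative_iff by simp
    qed (auto simp: chart_def eventually_at_filter)
    ultimately have "((\<lambda>y. (chart q y - chart q 0) / (y - 0)) \<longlongrightarrow> q) (at 0)"
      using filterlim_split_at by blast
    then show ?thesis using 3 by (simp add: has_field_derivative_iff dchart_def)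
  qed
qed

lemma abs_chart: "p \<in> {-1<..<1} \<Longrightarrow> 0 < q \<Longrightarrow> 1 - \<bar>chart q p\<bar> = (1 - \<bar>p\<bar>) powr q"
  using powr_mono2[of q "1 - \<bar>p\<bar>" 1] by (cases "p = 0") (auto simp: chart_def abs_mult abs_sgn_eq)

text \<open>The vanishing of \<open>F\<close> for \<open>\<bar>l\<bar> \<ge> r\<close> keeps the substitution away from the endpoints \<open>\<plusminus> 1\<close>, where
  the chart need not be differentiable.\<close>

lemma nn_integral_chart:
  fixes F :: "real \<Rightarrow> real"
  assumes [measurable]: "F \<in> borel_measurable borel" and q: "0 < q" and r: "0 < r" "r < 1"
    and zero: "\<And>l. r \<le> \<bar>l\<bar> \<Longrightarrow> F l = 0"
  shows "(\<integral>\<^sup>+ l. ennreal ((1 - \<bar>l\<bar>) powr \<alpha> * F l) * indicator {-r<..<r} l \<partial>lborel) =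
    ennreal q * (\<integral>\<^sup>+ p. ennreal ((1 - \<bar>p\<bar>) powr (q * (\<alpha> + 1) - 1)) * ennreal (F (chart q p)) * indicator {-1<..<1} p \<partial>lborel)"
proof -
  \<comment> \<open>The preimage of \<open>r\<close> under the chart.\<close>
  define a where "a = 1 - (1 - r) powr (1 / q)"
  have "(1 - r) powr (1 / q) < 1 powr (1 / q)" using q r by (intro powr_less_mono2) auto
  then have a: "0 < a" "a < 1" using r by (auto simp: a_def)
  have chart_a: "chart q a = r" using a q r by (simp add: chart_def) (simp add: a_def powr_powr)
  then have chart_a': "chart q (- a) = - r" by (simp add: chart_def)
  have "(\<integral>\<^sup>+ l. ennreal ((1 - \<bar>l\<bar>) powr \<alpha> * F l) * indicator {-r<..<r} l \<partial>lborel) =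
     (\<integral>\<^sup>+ l. ennreal ((1 - \<bar>l\<bar>) powr \<alpha> * F l) * indicator {chart q (- a)..chart q a} l \<partial>lborel)"
    by (intro nn_integral_cong) (auto simp: chart_a chart_a' zero split: split_indicator)
  also have "\<dots> = (\<integral>\<^sup>+ p. ennreal ((1 - \<bar>chart q p\<bar>) powr \<alpha> * F (chart q p) * dchart q p) * indicator {- a..a} p \<partial>lborel)"
    unfolding nn_integral_set_ennreal
  proof (rule nn_integral_substitution)
    show "set_borel_measurable borel {chart q (- a)..chart q a} (\<lambda>l. (1 - \<bar>l\<bar>) powr \<alpha> * F l)"
      unfolding set_borel_measurable_def by measurable
    show "continuous_on {- a..a} (dchart q)"
      by (rule continuous_on_subset[OF continuous_on_dchart]) (use a in auto)
    show "(chart q has_real_derivative dchart q x) (at x)" if "x \<in> {- a..a}" for x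
      using that a by (intro chart_has_derivative) auto
  qed (use a q in \<open>auto simp: dchart_def\<close>)
  also have "\<dots> = (\<integral>\<^sup>+ p. ennreal q * (ennreal ((1 - \<bar>p\<bar>) powr (q * (\<alpha> + 1) - 1)) * ennreal (F (chart q p)) * indicator {-1<..<1} p) \<partial>lborel)"
  proof (intro nn_integral_cong)
    fix p
    show "ennreal ((1 - \<bar>chart q p\<bar>) powr \<alpha> * F (chart q p) * dchart q p) * indicator {- a..a} p =
      ennreal q * (ennreal ((1 - \<bar>p\<bar>) powr (q * (\<alpha> + 1) - 1)) * ennreal (F (chart q p)) * indicator {-1<..<1} p)"
    proof (cases "p \<in> {-a..a}")
      case True
      then have p: "p \<in> {-1<..<1}" using a by auto
      have eq: "(1 - \<bar>chart q p\<bar>) powr \<alpha> * F (chart q p) * dchart q p = q * ((1 - \<bar>p\<bar>) powr (q * \<alpha> + (q - 1)) * F (chart q p))"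
        unfolding abs_chart[OF p q] dchart_def powr_add by (simp add: powr_powr)
      have exponent: "q * \<alpha> + (q - 1) = q * (\<alpha> + 1) - 1" by (simp add: algebra_simps)
      have "ennreal ((1 - \<bar>chart q p\<bar>) powr \<alpha> * F (chart q p) * dchart q p) =
          ennreal q * (ennreal ((1 - \<bar>p\<bar>) powr (q * (\<alpha> + 1) - 1)) * ennreal (F (chart q p)))"
        using q by (simp only: eq exponent) (simp add: ennreal_mult')
      then show ?thesis using True p by simp
    next
      case False
      have "F (chart q p) = 0" if p: "p \<in> {-1<..<1}"
      proof (rule zero)
        have "(1 - \<bar>p\<bar>) powr q \<le> (1 - a) powr q" using False p q by (intro powr_mono2) auto
        also have "\<dots> = 1 - r" using r q by (simp add: a_def powr_powr)
        finally show "r \<le> \<bar>chart q p\<bar>" using abs_chart[OF p q] by linarith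
      qed
      then show ?thesis using False by (auto split: split_indicator)
    qed
  qed
  also have "\<dots> = ennreal q * (\<integral>\<^sup>+ p. ennreal ((1 - \<bar>p\<bar>) powr (q * (\<alpha> + 1) - 1)) * ennreal (F (chart q p)) * indicator {-1<..<1} p \<partial>lborel)"
    by (rule nn_integral_cmult) measurable
  finally show ?thesis .
qed


lemma fst_snd_borel_measurable [measurable (raw)]:
  fixes f :: "'c \<Rightarrow> 'a::euclidean_space \<times> 'b::euclidean_space"
  assumes "f \<in> borel_measurable M"
  shows "(\<lambda>x. fst (f x)) \<in> borel_measurable M" "(\<lambda>x. snd (f x)) \<in> borel_measurable M"
  using measurable_compose[OF assms, of fst] measurable_compose[OF assms, of snd]
  by (simp_all add: borel_measurable_continuous_onI continuous_on_fst continuous_on_snd)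

text \<open>On the right the \<open>x\<close>-domain is enlarged to radius \<open>7\<close>, at no cost since \<open>F\<close> vanishes there; the
  additional room accommodates the target set of the contractions.\<close>

lemma nn_integral_cylinder_chart:
  fixes F :: "('a::euclidean_space \<times> real) \<Rightarrow> real"
  assumes F [measurable]: "F \<in> borel_measurable borel" and q: "0 < q" and r: "0 < r" "r < 1"
    and supp: "\<And>x l. F (x, l) \<noteq> 0 \<Longrightarrow> norm x < 1 \<and> \<bar>l\<bar> < r"
  shows "(\<integral>\<^sup>+ z. ennreal ((1 - \<bar>snd z\<bar>) powr \<alpha> * F z) * indicator (ball 0 1 \<times> {-r<..<r}) z \<partial>lborel) =
    ennreal q * (\<integral>\<^sup>+ z. ennreal ((1 - \<bar>snd z\<bar>) powr (q * (\<alpha> + 1) - 1)) * indicator (ball 0 7 \<times> {-1<..<1}) z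
      * ennreal (F (fst z, chart q (snd z))) \<partial>lborel)"
    (is "?lhs = ennreal q * ?rhs")
proof -
  have fubini: "(\<integral>\<^sup>+ z. H z \<partial>lborel) = (\<integral>\<^sup>+ x. \<integral>\<^sup>+ l. H (x, l) \<partial>lborel \<partial>lborel)"
    if "H \<in> borel_measurable borel" for H :: "('a \<times> real) \<Rightarrow> ennreal"
    using that lborel.nn_integral_fst[of H "lborel :: 'a measure"]
    by (simp add: lborel_prod borel_prod)
  have [measurable]: "ball 0 c \<times> {-b<..<b} \<in> sets (borel :: ('a \<times> real) measure)" for b c :: real
    by (intro borel_open open_Times) auto
  have "?lhs = (\<integral>\<^sup>+ x. \<integral>\<^sup>+ l. ennreal ((1 - \<bar>l\<bar>) powr \<alpha> * F (x, l)) * indicator (ball 0 1 \<times> {-r<..<r}) (x, l) \<partial>lborel \<partial>lborel)"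
    by (subst fubini) auto
  also have "\<dots> = (\<integral>\<^sup>+ x. ennreal q * (\<integral>\<^sup>+ p. ennreal ((1 - \<bar>p\<bar>) powr (q * (\<alpha> + 1) - 1))
      * indicator (ball 0 7 \<times> {-1<..<1}) (x, p) * ennreal (F (x, chart q p)) \<partial>lborel) \<partial>lborel)"
  proof (intro nn_integral_cong)
    fix x :: 'a
    show "(\<integral>\<^sup>+ l. ennreal ((1 - \<bar>l\<bar>) powr \<alpha> * F (x, l)) * indicator (ball 0 1 \<times> {-r<..<r}) (x, l) \<partial>lborel) =
      ennreal q * (\<integral>\<^sup>+ p. ennreal ((1 - \<bar>p\<bar>) powr (q * (\<alpha> + 1) - 1))
      * indicator (ball 0 7 \<times> {-1<..<1}) (x, p) * ennreal (F (x, chart q p)) \<partial>lborel)"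
    proof (cases "norm x < 1")
      case True
      have "(\<integral>\<^sup>+ l. ennreal ((1 - \<bar>l\<bar>) powr \<alpha> * F (x, l)) * indicator {-r<..<r} l \<partial>lborel) =
        ennreal q * (\<integral>\<^sup>+ p. ennreal ((1 - \<bar>p\<bar>) powr (q * (\<alpha> + 1) - 1)) * ennreal (F (x, chart q p)) * indicator {-1<..<1} p \<partial>lborel)"
        using supp by (intro nn_integral_chart q r) force+
      then show ?thesis using True by (simp add: indicator_times mult_ac)
    next
      case False
      then have "F (x, l) = 0" for l using supp by blast
      then show ?thesis by simp
    qed
  qed
  also have "\<dots> = ennreal q * (\<integral>\<^sup>+ x. (\<integral>\<^sup>+ p. ennreal ((1 - \<bar>p\<bar>) powr (q * (\<alpha> + 1) - 1))
      * indicator (ball 0 7 \<times> {-1<..<1}) (x, p) * ennreal (F (x, chart q p)) \<partial>lborel) \<partial>lborel)"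
    by (rule nn_integral_cmult) measurable
  also have "\<dots> = ennreal q * ?rhs"
    by (subst fubini) auto
  finally show ?thesis .
qed

section \<open>The weighted Sobolev inequality on the cylinder\<close>

text \<open>The target set is centred at distance \<open>5\<close> from the axis, so that the midpoint of any of its points
  (norm at least \<open>4\<close>) with a point of the unit ball has norm greater than \<open>1\<close>. The diameter bound \<open>16\<close> is \<open>14\<close> for the ball plus \<open>2\<close> for the interval.\<close>

lemma concave_power_weight_slab:
  fixes e :: "'a::euclidean_space"
  assumes e: "norm e = 1" and k: "0 \<le> k"
  shows "concave_power_weight (ball 0 7 \<times> {-1<..<1}) (ball (5 *\<^sub>R e) 1 \<times> {-1/2<..<1/2})
    (\<lambda>z :: 'a \<times> real. 1 - \<bar>snd z\<bar>) k 16"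
    (is "concave_power_weight ?D ?B ?d k 16")
proof
  show "open ?D" by (intro open_Times) auto
  show "convex ?D" by (intro convex_Times) auto
  show "norm (y - z) \<le> 16" if "y \<in> ?D" "z \<in> ?D" for y z
  proof -
    have "norm (y - z) \<le> norm (fst (y - z)) + norm (snd (y - z))"
      by (metis norm_Pair_le prod.collapse)
    also have "\<dots> \<le> (norm (fst y) + norm (fst z)) + (\<bar>snd y\<bar> + \<bar>snd z\<bar>)"
      by (intro add_mono) (auto simp: norm_triangle_ineq4)
    finally show ?thesis using that by (auto simp: mem_Times_iff)
  qed
  have "norm x < 7" if "dist (5 *\<^sub>R e) x < 1" for x
    using norm_triangle_ineq2[of x "5 *\<^sub>R e"] that e by (auto simp: dist_norm norm_minus_commute)
  then show B_sub: "?B \<subseteq> ?D" by auto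
  have openB: "open ?B" by (intro open_Times) auto
  then show "?B \<in> sets borel" by simp
  have "5 *\<^sub>R e \<in> ball (5 *\<^sub>R e) 1" "(0::real) \<in> {-1/2<..<1/2}" by auto
  then have "?B \<noteq> {}" by blast
  then have "\<not> negligible ?B" by (rule open_not_negligible[OF openB])
  then have "emeasure lborel ?B \<noteq> 0"
    using openB by (simp add: negligible_iff_null_sets null_sets_completion_iff null_sets_def)
  moreover have "bounded ?B" by (intro bounded_Times) auto
  then have "emeasure lborel ?B < \<infinity>" by (rule emeasure_bounded_finite)
  ultimately show "0 < measure lborel ?B"
    by (simp add: measure_def enn2real_positive_iff zero_less_iff_neq_zero)
  show "?d \<in> borel_measurable borel" by measurable
  show "(1 - s) * ?d z + s * ?d y \<le> ?d ((1 - s) *\<^sub>R z + s *\<^sub>R y)"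
    if "0 \<le> s" "s \<le> 1" for y z s
  proof -
    have "\<bar>(1 - s) * snd z + s * snd y\<bar> \<le> (1 - s) * \<bar>snd z\<bar> + s * \<bar>snd y\<bar>"
      using abs_triangle_ineq[of "(1 - s) * snd z" "s * snd y"] that by (simp add: abs_mult)
    then show ?thesis by (simp add: algebra_simps)
  qed
qed (use k in auto)

text \<open>In the chart the energy density \<open>\<bar>\<nabla>\<^sub>x f\<bar>\<^sup>2 + (1 - \<bar>l\<bar>)\<^sup>\<gamma> \<bar>\<partial>\<^sub>l f\<bar>\<^sup>2\<close> is comparable to \<open>\<bar>\<nabla>u\<bar>\<^sup>2\<close>, because
  \<open>q \<gamma> = 2 (q - 1)\<close> matches the square of the derivative of the chart. The constant is chosen before
  \<open>r\<close>, which makes the final estimate uniform in \<open>\<epsilon>\<close>.\<close>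

lemma weighted_sobolev_on_slab:
  fixes \<alpha> \<gamma> P k :: real
  assumes \<gamma>: "\<gamma> < 2" "0 < 2 * \<alpha> + \<gamma>" and k: "k = (2 * \<alpha> + \<gamma>) / (2 - \<gamma>)"
    and P: "2 \<le> P" "(1 - 2 / P) * (real DIM('a::euclidean_space) + 1 + k) \<le> 2"
  shows "\<exists>C\<ge>0. \<forall>r f G b. 0 < r \<longrightarrow> r < 1 \<longrightarrow>
    (\<forall>z. (f has_derivative (\<lambda>h. h \<bullet> G z)) (at z)) \<longrightarrow> continuous_on UNIV G \<longrightarrow>
    (\<forall>z. z \<notin> ball 0 1 \<times> {-r<..<r} \<longrightarrow> f z = 0 \<and> G z = 0) \<longrightarrow> (\<forall>z. \<bar>f z\<bar> \<le> b) \<longrightarrow>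
    ennreal (enn2real (\<integral>\<^sup>+ z. ennreal ((1 - \<bar>snd z\<bar>) powr \<alpha> * \<bar>f z\<bar> powr P)
        * indicator (ball 0 1 \<times> {-r<..<r}) z \<partial>lborel) powr (2 / P))
    \<le> ennreal C * (\<integral>\<^sup>+ z. ennreal ((1 - \<bar>snd z\<bar>) powr \<alpha> *
        ((norm (fst (G z)))\<^sup>2 + (1 - \<bar>snd z\<bar>) powr \<gamma> * (snd (G z))\<^sup>2))
        * indicator (ball 0 1 \<times> {-r<..<r}) (z :: 'a \<times> real) \<partial>lborel)"
proof -
  obtain e :: 'a where e: "norm e = 1" using vector_choose_size[of 1] by auto
  have k_nonneg: "0 \<le> k" using \<gamma> by (simp add: k)
  define \<Omega> :: "('a \<times> real) set" where "\<Omega> = ball 0 7 \<times> {-1<..<1}"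
  define B where "B = ball (5 *\<^sub>R e) 1 \<times> {-1/2<..<(1/2::real)}"
  define d where "d z = 1 - \<bar>snd z\<bar>" for z :: "'a \<times> real"
  interpret concave_power_weight \<Omega> B d k 16
    using concave_power_weight_slab[OF e k_nonneg] unfolding \<Omega>_def B_def d_def .
  define q where "q = 2 / (2 - \<gamma>)"
  have q: "0 < q" using \<gamma> by (simp add: q_def)
  have qk: "q * (\<alpha> + 1) - 1 = k" using \<gamma> by (simp add: q_def k field_simps)
  have q\<gamma>: "q * \<gamma> = 2 * (q - 1)" using \<gamma> by (simp add: q_def field_simps)
  have hdim_le: "(1 - 2 / P) * hdim \<le> 2" using P by (simp add: hdim_def add_ac)
  define K0 where "K0 = 4 powr P * decay_const (1 - 2 / P)"
  have K0: "0 \<le> K0" by (simp add: K0_def decay_const_def)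
  define C where "C = q powr (2 / P) * K0 * ((1 + q\<^sup>2) / q)"
  show ?thesis
  proof (intro exI[of _ C] conjI allI impI)
    show "0 \<le> C" using q K0 by (simp add: C_def)
    fix r b :: real and f and G :: "'a \<times> real \<Rightarrow> 'a \<times> real"
    let ?Q = "ball 0 1 \<times> {-r<..<r} :: ('a \<times> real) set"
    assume r: "0 < r" "r < 1" and deriv: "\<forall>z. (f has_derivative (\<lambda>h. h \<bullet> G z)) (at z)"
      and G_cont: "continuous_on UNIV G" and supp: "\<forall>z. z \<notin> ?Q \<longrightarrow> f z = 0 \<and> G z = 0"
      and bdd: "\<forall>z. \<bar>f z\<bar> \<le> b"
    have f0: "f z = 0" and G0: "G z = 0" if "z \<notin> ?Q" for z
      using supp that by blast+
    have f_cont: "continuous_on UNIV f"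
      using deriv by (intro continuous_at_imp_continuous_on) (blast intro: has_derivative_continuous)
    have [measurable]: "f \<in> borel_measurable borel" "G \<in> borel_measurable borel"
      using f_cont G_cont by (auto intro: borel_measurable_continuous_onI)
    define \<phi> where "\<phi> z = (fst z, chart q (snd z))" for z :: "'a \<times> real"
    have [measurable]: "\<phi> \<in> borel_measurable borel" unfolding \<phi>_def by measurable
    define u where "u z = f (\<phi> z)" for z
    define g where "g z = (fst (G (\<phi> z)), dchart q (snd z) * snd (G (\<phi> z)))" for z
    define H where "H z = (norm (fst (G z)))\<^sup>2 + (1 - \<bar>snd z\<bar>) powr \<gamma> * (snd (G z))\<^sup>2" for z
    have [measurable]: "H \<in> borel_measurable borel" unfolding H_def by measurable
    have \<phi>_deriv: "(\<phi> has_derivative (\<lambda>v. (fst v, dchart q (snd z) * snd v))) (at z)" if "z \<in> \<Omega>" for z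
    proof -
      have "(chart q has_derivative (*) (dchart q (snd z))) (at (snd z))"
        using chart_has_derivative[of "snd z" q] that by (auto simp: \<Omega>_def has_field_derivative_def)
      then have "(chart q \<circ> snd has_derivative (*) (dchart q (snd z)) \<circ> snd) (at z)"
        by (intro diff_chain_at) (auto intro!: derivative_eq_intros)
      then have "((\<lambda>z. chart q (snd z)) has_derivative (\<lambda>v. dchart q (snd z) * snd v)) (at z)"
        by (simp add: o_def)
      then show ?thesis unfolding \<phi>_def
        by (intro has_derivative_Pair) (auto intro!: derivative_eq_intros)
    qed
    interpret C1_dirichlet_function \<Omega> B d k 16 u g
    proof
      show "u \<in> borel_measurable borel" "g \<in> borel_measurable borel"
        unfolding u_def g_def by measurable
      show "(u has_derivative (\<lambda>v. v \<bullet> g z)) (at z)" if "z \<in> \<Omega>" for z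
      proof -
        have "(f \<circ> \<phi> has_derivative (\<lambda>h. h \<bullet> G (\<phi> z)) \<circ> (\<lambda>v. (fst v, dchart q (snd z) * snd v))) (at z)"
          by (intro diff_chain_at \<phi>_deriv that deriv[rule_format])
        then show ?thesis unfolding u_def g_def
          by (auto simp: o_def inner_prod_def mult_ac)
      qed
      have "continuous_on \<Omega> \<phi>"
        using \<phi>_deriv by (intro continuous_at_imp_continuous_on) (blast intro: has_derivative_continuous)
      then have "continuous_on \<Omega> (\<lambda>z. G (\<phi> z))"
        by (intro continuous_on_compose2[OF G_cont]) auto
      moreover have "continuous_on \<Omega> (\<lambda>z. dchart q (snd z))"
        by (intro continuous_on_compose2[OF continuous_on_dchart] continuous_intros) (auto simp: \<Omega>_def)
      ultimately show "continuous_on \<Omega> g" unfolding g_def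
        by (intro continuous_intros)
      show "u ((1 / 2) *\<^sub>R z + (1 / 2) *\<^sub>R y) = 0" if "y \<in> B" "u z \<noteq> 0" for y z
      proof -
        have "\<phi> z \<in> ?Q" using that supp unfolding u_def by blast
        then have z: "norm (fst z) < 1" by (simp add: \<phi>_def)
        have y: "norm (fst y) > 4" using that norm_triangle_ineq2[of "5 *\<^sub>R e" "fst y"] e
          by (auto simp: B_def dist_norm)
        have "norm (fst y) - norm (fst z) \<le> norm (fst y + fst z)"
          by (metis norm_diff_ineq)
        then have "\<not> norm ((1 / 2) *\<^sub>R (fst z + fst y)) < 1" using y z by (simp add: add.commute)
        then have "\<phi> ((1 / 2) *\<^sub>R z + (1 / 2) *\<^sub>R y) \<notin> ?Q"
          by (auto simp: \<phi>_def scaleR_add_right)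
        then show ?thesis using supp unfolding u_def by blast
      qed
    qed
    have transform: "(\<integral>\<^sup>+ z. ennreal ((1 - \<bar>snd z\<bar>) powr \<alpha> * F z) * indicator ?Q z \<partial>lborel) =
        ennreal q * (\<integral>\<^sup>+ z. ennreal (F (\<phi> z)) \<partial>\<mu>)"
      if [measurable]: "F \<in> borel_measurable borel" and "\<And>z. z \<notin> ?Q \<Longrightarrow> F z = 0" for F
    proof -
      have "norm x < 1 \<and> \<bar>l\<bar> < r" if "F (x, l) \<noteq> 0" for x l
      proof -
        have "(x, l) \<in> ?Q" using that \<open>\<And>z. z \<notin> ?Q \<Longrightarrow> F z = 0\<close> by blast
        then show ?thesis by auto
      qed
      then have "(\<integral>\<^sup>+ z. ennreal ((1 - \<bar>snd z\<bar>) powr \<alpha> * F z) * indicator ?Q z \<partial>lborel) =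
          ennreal q * (\<integral>\<^sup>+ z. ennreal ((1 - \<bar>snd z\<bar>) powr k) * indicator \<Omega> z * ennreal (F (\<phi> z)) \<partial>lborel)"
        by (subst nn_integral_cylinder_chart[OF _ q r]) (auto simp: qk \<phi>_def \<Omega>_def)
      also have "(\<integral>\<^sup>+ z. ennreal ((1 - \<bar>snd z\<bar>) powr k) * indicator \<Omega> z * ennreal (F (\<phi> z)) \<partial>lborel) =
          (\<integral>\<^sup>+ z. ennreal (F (\<phi> z)) \<partial>\<mu>)"
        by (subst nn_integral_\<mu>) (auto simp: weight_def d_def)
      finally show ?thesis .
    qed
    define I where "I = enn2real (\<integral>\<^sup>+ z. ennreal (\<bar>u z\<bar> powr P) \<partial>\<mu>)"
    have "0 \<le> I" by (simp add: I_def)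
    have "enn2real (\<integral>\<^sup>+ z. ennreal ((1 - \<bar>snd z\<bar>) powr \<alpha> * \<bar>f z\<bar> powr P) * indicator ?Q z \<partial>lborel) = q * I"
    proof (subst transform)
      show "\<bar>f z\<bar> powr P = 0" if "z \<notin> ?Q" for z using f0[OF that] by simp
    qed (use q in \<open>auto simp: I_def u_def enn2real_mult\<close>)
    then have "ennreal (enn2real (\<integral>\<^sup>+ z. ennreal ((1 - \<bar>snd z\<bar>) powr \<alpha> * \<bar>f z\<bar> powr P) * indicator ?Q z \<partial>lborel) powr (2 / P))
      = ennreal (q powr (2 / P)) * ennreal (I powr (2 / P))"
      using q \<open>0 \<le> I\<close> by (simp add: powr_mult ennreal_mult)
    also have "\<dots> \<le> ennreal (q powr (2 / P)) * (ennreal K0 * (\<integral>\<^sup>+ z. ennreal ((norm (g z))\<^sup>2) \<partial>\<mu>))"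
      unfolding K0_def I_def
    proof (intro mult_left_mono sobolev[OF P(1) hdim_le])
      show "\<bar>u z\<bar> \<le> b" for z using bdd unfolding u_def by blast
    qed simp
    also have "\<dots> \<le> ennreal (q powr (2 / P)) * (ennreal K0 * (\<integral>\<^sup>+ z. ennreal (1 + q\<^sup>2) * ennreal (H (\<phi> z)) \<partial>\<mu>))"
    proof -
      have "(norm (g z))\<^sup>2 \<le> (1 + q\<^sup>2) * H (\<phi> z)" if z: "z \<in> \<Omega>" for z
      proof -
        have p: "snd z \<in> {-1<..<1}" using z by (auto simp: \<Omega>_def)
        define s X where "s = snd (G (\<phi> z))" and "X = (norm (fst (G (\<phi> z))))\<^sup>2"
        define Y where "Y = (1 - \<bar>snd z\<bar>) powr (2 * (q - 1)) * s\<^sup>2"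
        have XY: "0 \<le> X" "0 \<le> Y" by (auto simp: X_def Y_def)
        have "(dchart q (snd z))\<^sup>2 = q\<^sup>2 * (1 - \<bar>snd z\<bar>) powr (2 * (q - 1))"
          unfolding dchart_def mult_2 powr_add by (simp add: power2_eq_square mult_ac)
        then have 1: "(norm (g z))\<^sup>2 = X + q\<^sup>2 * Y"
          by (simp add: g_def norm_Pair X_def Y_def s_def power_mult_distrib)
        have 2: "H (\<phi> z) = X + Y"
          using abs_chart[OF p q] by (simp add: H_def \<phi>_def X_def Y_def s_def powr_powr q\<gamma>)
        show ?thesis unfolding 1 2 using XY by (simp add: algebra_simps)
      qed
      then have "ennreal ((norm (g z))\<^sup>2) \<le> ennreal ((1 + q\<^sup>2) * H (\<phi> z))" if "z \<in> \<Omega>" for z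
        using that by (intro ennreal_leI) blast
      then have "ennreal ((norm (g z))\<^sup>2) \<le> ennreal (1 + q\<^sup>2) * ennreal (H (\<phi> z))" if "z \<in> \<Omega>" for z
        using that by (subst ennreal_mult'[symmetric]) auto
      then have "weight z * ennreal ((norm (g z))\<^sup>2) \<le> weight z * (ennreal (1 + q\<^sup>2) * ennreal (H (\<phi> z)))" for z
      proof (cases "z \<in> \<Omega>")
        case True
        then show ?thesis
          by (intro mult_left_mono \<open>\<And>z. z \<in> \<Omega> \<Longrightarrow> ennreal ((norm (g z))\<^sup>2) \<le> ennreal (1 + q\<^sup>2) * ennreal (H (\<phi> z))\<close>) auto
      qed (simp add: weight_def)
      then have "(\<integral>\<^sup>+ z. ennreal ((norm (g z))\<^sup>2) \<partial>\<mu>) \<le> (\<integral>\<^sup>+ z. ennreal (1 + q\<^sup>2) * ennreal (H (\<phi> z)) \<partial>\<mu>)"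
        by (subst (1 2) nn_integral_\<mu>) (auto intro!: nn_integral_mono)
      then show ?thesis by (intro mult_left_mono) auto
    qed
    also have "\<dots> = ennreal C * (ennreal q * (\<integral>\<^sup>+ z. ennreal (H (\<phi> z)) \<partial>\<mu>))"
    proof -
      have "C * q = q powr (2 / P) * (K0 * (1 + q\<^sup>2))" using q by (simp add: C_def)
      then have "ennreal C * ennreal q = ennreal (q powr (2 / P)) * (ennreal K0 * ennreal (1 + q\<^sup>2))"
        using q K0 \<open>0 \<le> C\<close> by (simp add: ennreal_mult[symmetric] del: ennreal_plus)
      then show ?thesis by (subst nn_integral_cmult) (auto simp: mult.assoc[symmetric] simp del: ennreal_plus)
    qed
    also have "ennreal q * (\<integral>\<^sup>+ z. ennreal (H (\<phi> z)) \<partial>\<mu>) =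
        (\<integral>\<^sup>+ z. ennreal ((1 - \<bar>snd z\<bar>) powr \<alpha> * H z) * indicator ?Q z \<partial>lborel)"
    proof (rule transform[symmetric])
      show "H z = 0" if "z \<notin> ?Q" for z using G0[OF that] by (simp add: H_def)
    qed measurable
    finally show "ennreal (enn2real (\<integral>\<^sup>+ z. ennreal ((1 - \<bar>snd z\<bar>) powr \<alpha> * \<bar>f z\<bar> powr P) * indicator ?Q z \<partial>lborel) powr (2 / P))
      \<le> ennreal C * (\<integral>\<^sup>+ z. ennreal ((1 - \<bar>snd z\<bar>) powr \<alpha> *
        ((norm (fst (G z)))\<^sup>2 + (1 - \<bar>snd z\<bar>) powr \<gamma> * (snd (G z))\<^sup>2)) * indicator ?Q z \<partial>lborel)"
      unfolding H_def .
  qed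
qed


theorem corollary1p5:
  fixes N :: nat and m \<alpha> \<beta> P :: real
  assumes "N \<ge> 2" and "CARD('n::finite) = N - 1"
    and "m > -1" and "\<alpha> > -1" and "\<beta> > 0"
    and "- 2 * \<alpha> * (1 + m) < \<beta> * m" and "\<beta> * m < 2 * (1 + m)"
    and "2 \<le> P" and "P \<le> P_cr N m \<alpha> \<beta>"
  shows "\<exists>C>0. \<forall>\<epsilon>\<in>{0<..<1/2}. \<forall>f\<in>test_functions (cylinder m \<epsilon> :: ((real ^ 'n) \<times> real) set).
    (LINT (x, l):cylinder m \<epsilon>|lborel. (1 - \<bar>l\<bar>) powr \<alpha> * \<bar>f (x, l)\<bar> powr P) powr (2 / P)
    \<le> C * (LINT (x, l):cylinder m \<epsilon>|lborel. (1 - \<bar>l\<bar>) powr \<alpha> *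
        ((norm (gradient (\<lambda>y. f (y, l)) x))\<^sup>2 +
         (1 - \<bar>l\<bar>) powr \<beta> / \<epsilon> powr \<beta> * \<bar>deriv (\<lambda>s. f (x, s)) l\<bar>\<^sup>2))"
proof -
  note m = \<open>m > -1\<close>
  define \<gamma> where "\<gamma> = \<beta> * m / (1 + m)"
  define k where "k = (2 * \<alpha> + \<gamma>) / (2 - \<gamma>)"
  have \<gamma>: "\<gamma> < 2" "0 < 2 * \<alpha> + \<gamma>" using assms by (auto simp: \<gamma>_def field_simps)
  have k_pos: "0 < k" using \<gamma> by (simp add: k_def)
  have "k = ((1 + m) * (2 * \<alpha> + \<gamma>)) / ((1 + m) * (2 - \<gamma>))" using m by (simp add: k_def)
  also have "\<dots> = (2 * \<alpha> * (1 + m) + \<beta> * m) / (2 * (1 + m) - \<beta> * m)"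
  proof -
    have *: "\<beta> * m = (1 + m) * \<gamma>" using m by (simp add: \<gamma>_def)
    show ?thesis unfolding * by (simp add: algebra_simps)
  qed
  finally have P_cr: "P_cr N m \<alpha> \<beta> = 2 * (real N + k) / (real N + k - 2)" by (simp add: P_cr_def)
  have Q: "real N + k > 2" using \<open>N \<ge> 2\<close> k_pos by linarith
  have "P * (real N + k - 2) \<le> 2 * (real N + k)"
    using \<open>P \<le> P_cr N m \<alpha> \<beta>\<close> Q by (simp add: P_cr pos_le_divide_eq)
  then have "(1 - 2 / P) * (real N + k) \<le> 2"
    using \<open>2 \<le> P\<close> by (simp add: field_simps)
  moreover have "real DIM(real ^ 'n) + 1 = real N" using assms(1,2) by simp
  ultimately have P: "(1 - 2 / P) * (real DIM(real ^ 'n) + 1 + k) \<le> 2" by simp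
  obtain C where C: "0 \<le> C" and sobolev: "\<And>r f G b. 0 < r \<Longrightarrow> r < 1 \<Longrightarrow>
    (\<And>z. (f has_derivative (\<lambda>h. h \<bullet> G z)) (at z)) \<Longrightarrow> continuous_on UNIV G \<Longrightarrow>
    (\<And>z. z \<notin> ball 0 1 \<times> {-r<..<r} \<Longrightarrow> f z = 0 \<and> G z = 0) \<Longrightarrow> (\<And>z. \<bar>f z\<bar> \<le> b) \<Longrightarrow>
    ennreal (enn2real (\<integral>\<^sup>+ z. ennreal ((1 - \<bar>snd z\<bar>) powr \<alpha> * \<bar>f z\<bar> powr P)
        * indicator (ball 0 1 \<times> {-r<..<r}) z \<partial>lborel) powr (2 / P))
    \<le> ennreal C * (\<integral>\<^sup>+ z. ennreal ((1 - \<bar>snd z\<bar>) powr \<alpha> *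
        ((norm (fst (G z)))\<^sup>2 + (1 - \<bar>snd z\<bar>) powr \<gamma> * (snd (G z))\<^sup>2))
        * indicator (ball 0 1 \<times> {-r<..<r}) (z :: (real ^ 'n) \<times> real) \<partial>lborel)"
    using weighted_sobolev_on_slab[OF \<gamma> k_def \<open>2 \<le> P\<close> P] by blast
  show ?thesis
  proof (intro exI[of _ "C + 1"] conjI ballI)
    \<comment> \<open>Adding one makes the constant strictly positive.\<close>
    show "0 < C + 1" using C by simp
    fix \<epsilon> :: real and f :: "(real ^ 'n) \<times> real \<Rightarrow> real"
    assume \<epsilon>: "\<epsilon> \<in> {0<..<1/2}" and f: "f \<in> test_functions (cylinder m \<epsilon>)"
    define r where "r = 1 - \<epsilon> powr (1 + m)"
    have "\<epsilon> powr (1 + m) < 1 powr (1 + m)" using \<epsilon> m by (intro powr_less_mono2) auto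
    then have r: "0 < r" "r < 1" using \<epsilon> by (auto simp: r_def)
    define Q where "Q = (ball 0 1 \<times> {-r<..<r} :: ((real ^ 'n) \<times> real) set)"
    have cyl: "cylinder m \<epsilon> = Q" by (auto simp: cylinder_def Q_def r_def)
    have openQ: "open Q" unfolding Q_def by (intro open_Times) auto
    then have [measurable]: "Q \<in> sets borel" by simp
    define S where "S = closure {z. f z \<noteq> 0}"
    have S: "compact S" "S \<subseteq> Q" and f0: "\<And>z. z \<notin> S \<Longrightarrow> f z = 0"
      using f closure_subset[of "{z. f z \<noteq> 0}"] unfolding test_functions_def S_def cyl by auto
    obtain G where G: "\<And>z. (f has_derivative (\<lambda>h. h \<bullet> G z)) (at z)" and G_cont: "continuous_on UNIV G"
      and G0: "\<And>z. z \<notin> S \<Longrightarrow> G z = 0"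
      using test_function_gradient[OF f] openQ unfolding cyl S_def by blast
    have f_cont: "continuous_on UNIV f"
      using G by (intro continuous_at_imp_continuous_on) (blast intro: has_derivative_continuous)
    have [measurable]: "f \<in> borel_measurable borel" "G \<in> borel_measurable borel"
      using f_cont G_cont by (auto intro: borel_measurable_continuous_onI)
    obtain b where b: "0 < b" "\<And>z. z \<in> S \<Longrightarrow> \<bar>f z\<bar> \<le> b"
      using compact_imp_bounded[OF compact_continuous_image[OF continuous_on_subset[OF f_cont] S(1)]]
      by (auto simp: bounded_pos)
    have f_bdd: "\<bar>f z\<bar> \<le> b" for z using b f0[of z] by (cases "z \<in> S") auto
    define X where "X z = (1 - \<bar>snd z\<bar>) powr \<alpha> * \<bar>f z\<bar> powr P" for z
    define Y where "Y z = (1 - \<bar>snd z\<bar>) powr \<alpha> * ((norm (fst (G z)))\<^sup>2 +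
      (1 - \<bar>snd z\<bar>) powr \<beta> / \<epsilon> powr \<beta> * (snd (G z))\<^sup>2)" for z
    have [measurable]: "X \<in> borel_measurable borel" "Y \<in> borel_measurable borel"
      unfolding X_def Y_def by measurable
    have lhs: "(LINT (x, l):cylinder m \<epsilon>|lborel. (1 - \<bar>l\<bar>) powr \<alpha> * \<bar>f (x, l)\<bar> powr P) =
        enn2real (\<integral>\<^sup>+ z. ennreal (X z) * indicator Q z \<partial>lborel)"
    proof -
      have "(LINT (x, l):cylinder m \<epsilon>|lborel. (1 - \<bar>l\<bar>) powr \<alpha> * \<bar>f (x, l)\<bar> powr P) =
          (\<integral> z. indicator Q z *\<^sub>R X z \<partial>lborel)"
        unfolding set_lebesgue_integral_def cyl X_def by (simp add: case_prod_beta')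
      also have "\<dots> = enn2real (\<integral>\<^sup>+ z. ennreal (indicator Q z *\<^sub>R X z) \<partial>lborel)"
        by (intro integral_eq_nn_integral) (auto simp: X_def)
      also have "(\<integral>\<^sup>+ z. ennreal (indicator Q z *\<^sub>R X z) \<partial>lborel) = (\<integral>\<^sup>+ z. ennreal (X z) * indicator Q z \<partial>lborel)"
        by (intro nn_integral_cong) (auto split: split_indicator)
      finally show ?thesis .
    qed
    have rhs: "ennreal (LINT (x, l):cylinder m \<epsilon>|lborel. (1 - \<bar>l\<bar>) powr \<alpha> *
        ((norm (gradient (\<lambda>y. f (y, l)) x))\<^sup>2 +
         (1 - \<bar>l\<bar>) powr \<beta> / \<epsilon> powr \<beta> * \<bar>deriv (\<lambda>s. f (x, s)) l\<bar>\<^sup>2)) =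
        (\<integral>\<^sup>+ z. ennreal (Y z) * indicator Q z \<partial>lborel)"
    proof -
      have "\<bar>snd z\<bar> < 1" if "z \<in> S" for z
        using subsetD[OF S(2) that] r by (auto simp: Q_def)
      then have "continuous_on S Y" unfolding Y_def
        using \<epsilon> by (intro continuous_intros continuous_on_subset[OF G_cont]) force+
      then have "integrable lborel (\<lambda>z. indicator S z *\<^sub>R Y z)"
        by (rule borel_integrable_compact[OF S(1)])
      also have "(\<lambda>z. indicator S z *\<^sub>R Y z) = (\<lambda>z. indicator Q z *\<^sub>R Y z)"
        using S(2) G0 by (auto simp: fun_eq_iff Y_def split: split_indicator)
      finally have int: "integrable lborel (\<lambda>z. indicator Q z *\<^sub>R Y z)" .
      have "gradient (\<lambda>y. f (y, l)) x = fst (G (x, l))" "deriv (\<lambda>s. f (x, s)) l = snd (G (x, l))" for x l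
        using partial_gradient[OF G[of "(x, l)"]] by auto
      then have "(LINT (x, l):cylinder m \<epsilon>|lborel. (1 - \<bar>l\<bar>) powr \<alpha> *
        ((norm (gradient (\<lambda>y. f (y, l)) x))\<^sup>2 +
         (1 - \<bar>l\<bar>) powr \<beta> / \<epsilon> powr \<beta> * \<bar>deriv (\<lambda>s. f (x, s)) l\<bar>\<^sup>2)) = (\<integral> z. indicator Q z *\<^sub>R Y z \<partial>lborel)"
        unfolding set_lebesgue_integral_def cyl Y_def by (simp add: case_prod_beta')
      also have "ennreal \<dots> = (\<integral>\<^sup>+ z. ennreal (indicator Q z *\<^sub>R Y z) \<partial>lborel)"
        by (rule nn_integral_eq_integral[OF int, symmetric]) (auto simp: Y_def)
      also have "\<dots> = (\<integral>\<^sup>+ z. ennreal (Y z) * indicator Q z \<partial>lborel)"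
        by (intro nn_integral_cong) (auto split: split_indicator)
      finally show ?thesis .
    qed
    have "ennreal (enn2real (\<integral>\<^sup>+ z. ennreal (X z) * indicator Q z \<partial>lborel) powr (2 / P)) \<le>
      ennreal C * (\<integral>\<^sup>+ z. ennreal ((1 - \<bar>snd z\<bar>) powr \<alpha> *
        ((norm (fst (G z)))\<^sup>2 + (1 - \<bar>snd z\<bar>) powr \<gamma> * (snd (G z))\<^sup>2)) * indicator Q z \<partial>lborel)"
      unfolding X_def Q_def
    proof (rule sobolev[OF r G G_cont _ f_bdd])
      show "f z = 0 \<and> G z = 0" if "z \<notin> ball 0 1 \<times> {-r<..<r}" for z
        using that S(2) f0 G0 unfolding Q_def by blast
    qed
    also have "\<dots> \<le> ennreal (C + 1) * (\<integral>\<^sup>+ z. ennreal (Y z) * indicator Q z \<partial>lborel)"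
    proof (rule mult_mono[OF _ nn_integral_mono])
      fix z :: "(real ^ 'n) \<times> real"
      show "ennreal ((1 - \<bar>snd z\<bar>) powr \<alpha> *
        ((norm (fst (G z)))\<^sup>2 + (1 - \<bar>snd z\<bar>) powr \<gamma> * (snd (G z))\<^sup>2)) * indicator Q z
        \<le> ennreal (Y z) * indicator Q z"
      proof (cases "z \<in> Q")
        case True
        \<comment> \<open>Here the coefficient \<open>\<epsilon>\<close> is absorbed: \<open>\<epsilon>\<close> is less than \<open>t\<close> to the power \<open>1 / (1 + m)\<close>.\<close>
        define t where "t = 1 - \<bar>snd z\<bar>"
        have t: "\<epsilon> powr (1 + m) < t" using True by (auto simp: Q_def t_def r_def)
        then have t_pos: "0 < t" using powr_ge_zero[of \<epsilon> "1 + m"] by linarith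
        have "\<epsilon> powr \<beta> = (\<epsilon> powr (1 + m)) powr (\<beta> / (1 + m))" using m by (simp add: powr_powr)
        also have "\<dots> \<le> t powr (\<beta> / (1 + m))" using t m \<open>\<beta> > 0\<close> by (intro powr_mono2) auto
        finally have "t powr \<gamma> * \<epsilon> powr \<beta> \<le> t powr \<gamma> * t powr (\<beta> / (1 + m))"
          by (intro mult_left_mono) auto
        also have "\<dots> = t powr \<beta>"
        proof -
          have "\<gamma> + \<beta> / (1 + m) = \<beta> * (1 + m) / (1 + m)"
            by (simp add: \<gamma>_def add_divide_distrib[symmetric] distrib_left)
          then have "\<gamma> + \<beta> / (1 + m) = \<beta>" using m by simp
          then show ?thesis by (simp add: powr_add[symmetric])
        qed
        finally have "t powr \<gamma> \<le> t powr \<beta> / \<epsilon> powr \<beta>" using \<epsilon> by (simp add: pos_le_divide_eq)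
        then show ?thesis unfolding Y_def t_def[symmetric]
          by (intro mult_right_mono ennreal_leI mult_left_mono add_left_mono) auto
      qed simp
    qed (use C in auto)
    finally have "ennreal (enn2real (\<integral>\<^sup>+ z. ennreal (X z) * indicator Q z \<partial>lborel) powr (2 / P)) \<le>
      ennreal ((C + 1) * (LINT (x, l):cylinder m \<epsilon>|lborel. (1 - \<bar>l\<bar>) powr \<alpha> *
        ((norm (gradient (\<lambda>y. f (y, l)) x))\<^sup>2 +
         (1 - \<bar>l\<bar>) powr \<beta> / \<epsilon> powr \<beta> * \<bar>deriv (\<lambda>s. f (x, s)) l\<bar>\<^sup>2)))"
      unfolding rhs[symmetric] using C by (subst ennreal_mult') auto
    moreover have "0 \<le> (C + 1) * (LINT (x, l):cylinder m \<epsilon>|lborel. (1 - \<bar>l\<bar>) powr \<alpha> *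
        ((norm (gradient (\<lambda>y. f (y, l)) x))\<^sup>2 +
         (1 - \<bar>l\<bar>) powr \<beta> / \<epsilon> powr \<beta> * \<bar>deriv (\<lambda>s. f (x, s)) l\<bar>\<^sup>2))"
      unfolding set_lebesgue_integral_def using C
      by (intro mult_nonneg_nonneg integral_nonneg_AE) (auto simp: case_prod_beta')
    ultimately show "(LINT (x, l):cylinder m \<epsilon>|lborel. (1 - \<bar>l\<bar>) powr \<alpha> * \<bar>f (x, l)\<bar> powr P) powr (2 / P)
      \<le> (C + 1) * (LINT (x, l):cylinder m \<epsilon>|lborel. (1 - \<bar>l\<bar>) powr \<alpha> *
        ((norm (gradient (\<lambda>y. f (y, l)) x))\<^sup>2 +
         (1 - \<bar>l\<bar>) powr \<beta> / \<epsilon> powr \<beta> * \<bar>deriv (\<lambda>s. f (x, s)) l\<bar>\<^sup>2))"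
      unfolding lhs by (simp only: ennreal_le_iff)
  qed
qed

end
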